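(* The following holds for every $\varepsilon>0$ that is sufficiently small (smaller than some absolute constant). Suppose $\mathbf{A}$ is an algorithm that takes any finite metric space $X$ with a constant-time distance oracle and $\operatorname{diam}(X)\le1$ as input, and $\varepsilon$-approximates the barcode of $H_2(\operatorname{VR}(X)_\bullet)$ of the Vietoris--Rips complex in the (additive) bottleneck distance. Suppose $\mathbf{A}$ takes $\mathcal{O}(|X|^q)$ time for some $q\ge1$. Then the rank of an $\mathbb{F}_2$-matrix $M$ with $m$ non-zero entries can be computed in $\mathcal{O}(m^q)$ time.
   Context: For a metric space $X$ and $t\ge0$, the Vietoris--Rips complex $\operatorname{VR}(X)_t$ is the simplicial complex on $X$ whose $k$-simplices are the subsets $\sigma\subseteq X$ with $|\sigma|=k+1$ and $\operatorname{diam}(\sigma)\le 2t$. These complexes form a filtration in $t$; applying $H_2(-;\mathbb{F}_2)$ gives a $1$-parameter persistence module $H_2(\operatorname{VR}(X)_\bullet)$, which has a barcode. Homology is taken with $\mathbb{F}_2$-coefficients. $\mathbf{A}$ $\varepsilon$-approximates the barcode if for every admissible $X$ it outputs a barcode whose bottleneck distance to the barcode of $H_2(\operatorname{VR}(X)_\bullet)$ is at most $\varepsilon$; by the isometry theorem, the bottleneck distance equals the interleaving distance of the corresponding persistence modules. It is assumed that the non-zero entries of $M$ can be accessed in constant amortized time. *)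

theory Defs
  imports
    "HOL-Analysis.Abstract_Metric_Spaces"
    "HOL-Library.Landau_Symbols"
    "HOL-Library.Extended_Real"
    "HOL-Library.Multiset"
    "HOL-Library.Z2"
    "HOL-Algebra.AbelCoset"
    "Jordan_Normal_Form.DL_Rank"
begin

section \<open>Simplicial homology with coefficients in the field with two elements\<close>

text \<open>
  Vector spaces are records of type \<open>module\<close> over \<open>class_ring :: bit ring\<close>, the field with two
  elements (type \<open>bit\<close> of \<^theory>\<open>HOL-Library.Z2\<close>). The fields \<open>mult\<close> and \<open>one\<close>, which the
  record type inherits from rings, carry no meaning for vector spaces and are left undefined.
\<close>

definition free_space :: "'i set \<Rightarrow> (bit, 'i \<Rightarrow> bit) module" where
  "free_space S =
    \<lparr>carrier = {c. finite {i. c i \<noteq> 0} \<and> {i. c i \<noteq> 0} \<subseteq> S},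
     mult = undefined, one = undefined,
     zero = (\<lambda>_. 0), add = (\<lambda>c c' i. c i + c' i), smult = (\<lambda>a c i. a * c i)\<rparr>"

definition quotient_space :: "('r, 'b) module \<Rightarrow> 'b set \<Rightarrow> ('r, 'b set) module" where
  "quotient_space V U =
    \<lparr>carrier = a_rcosets\<^bsub>V\<^esub> U,
     mult = undefined, one = undefined,
     zero = U, add = set_add V, smult = (\<lambda>a S. \<Union>x\<in>S. U +>\<^bsub>V\<^esub> (a \<odot>\<^bsub>V\<^esub> x))\<rparr>"

text \<open>A simplicial complex is given by the set of its (finite, nonempty) simplices.\<close>

definition simplices :: "'a set set \<Rightarrow> nat \<Rightarrow> 'a set set" where
  "simplices K k = {\<sigma> \<in> K. finite \<sigma> \<and> card \<sigma> = k + 1}"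

definition chains :: "'a set set \<Rightarrow> nat \<Rightarrow> (bit, 'a set \<Rightarrow> bit) module" where
  "chains K k = free_space (simplices K k)"

text \<open>
  The coefficient of \<open>\<tau>\<close> in the boundary of \<open>c\<close> is the sum of the coefficients of the simplices
  having \<open>\<tau>\<close> as a facet. The empty set is not a simplex, so that vertices have boundary \<open>0\<close>.
\<close>

definition boundary :: "('a set \<Rightarrow> bit) \<Rightarrow> 'a set \<Rightarrow> bit" where
  "boundary c \<tau> =
    (if \<tau> = {} then 0 else \<Sum>\<sigma> | c \<sigma> \<noteq> 0 \<and> (\<exists>x. x \<notin> \<tau> \<and> \<sigma> = insert x \<tau>). c \<sigma>)"

definition cycles :: "'a set set \<Rightarrow> nat \<Rightarrow> ('a set \<Rightarrow> bit) set" where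
  "cycles K k = {c \<in> carrier (chains K k). boundary c = (\<lambda>_. 0)}"

definition boundaries :: "'a set set \<Rightarrow> nat \<Rightarrow> ('a set \<Rightarrow> bit) set" where
  "boundaries K k = boundary ` carrier (chains K (k + 1))"

definition homology :: "'a set set \<Rightarrow> nat \<Rightarrow> (bit, ('a set \<Rightarrow> bit) set) module" where
  "homology K k = quotient_space ((chains K k)\<lparr>carrier := cycles K k\<rparr>) (boundaries K k)"

text \<open>
  The map induced by an inclusion of \<open>K\<close> into \<open>L\<close> sends the class \<open>S = z + boundaries K k\<close> to the
  class \<open>z + boundaries L k = S + boundaries L k\<close>.
\<close>

definition homology_inclusion ::
    "'a set set \<Rightarrow> nat \<Rightarrow> ('a set \<Rightarrow> bit) set \<Rightarrow> ('a set \<Rightarrow> bit) set" where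
  "homology_inclusion L k S = S <+>\<^bsub>chains L k\<^esub> boundaries L k"


section \<open>Persistence modules and barcodes\<close>

text \<open>
  One-parameter persistence modules, indexed by the real numbers \<open>t \<ge> 0\<close>; the values of the two
  components at other parameters are irrelevant. \<open>shift M s t\<close> is the structure map from
  \<open>space_at M s\<close> to \<open>space_at M t\<close> for \<open>0 \<le> s \<le> t\<close>.
\<close>

record 'b pmodule =
  space_at :: "real \<Rightarrow> (bit, 'b) module"
  shift :: "real \<Rightarrow> real \<Rightarrow> 'b \<Rightarrow> 'b"

definition pmodule_iso :: "'b pmodule \<Rightarrow> 'c pmodule \<Rightarrow> bool" where
  "pmodule_iso M N \<longleftrightarrow> (\<exists>\<psi>.
     (\<forall>t\<ge>0. \<psi> t \<in> module_hom class_ring (space_at M t) (space_at N t) \<and>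
        bij_betw (\<psi> t) (carrier (space_at M t)) (carrier (space_at N t))) \<and>
     (\<forall>s t. 0 \<le> s \<longrightarrow> s \<le> t \<longrightarrow>
        (\<forall>x\<in>carrier (space_at M s). \<psi> t (shift M s t x) = shift N s t (\<psi> s x))))"

text \<open>
  A bar \<open>(b, d)\<close> stands for the half-open interval \<open>[b, d)\<close>, where \<open>d\<close> may be infinite.
  The filtrations considered here change only finitely often and each complex contains its
  limit from the right, so that only intervals of this form occur.
\<close>

type_synonym bar = "real \<times> ereal"

definition alive :: "real \<Rightarrow> bar \<Rightarrow> bool" where
  "alive t I \<longleftrightarrow> fst I \<le> t \<and> ereal t < snd I"

definition barcode :: "bar multiset \<Rightarrow> bool" where
  "barcode B \<longleftrightarrow> (\<forall>I\<in>#B. 0 \<le> fst I \<and> ereal (fst I) < snd I)"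

text \<open>
  The direct sum of the interval modules of the bars in \<open>B\<close>; the pairs \<open>(I, i)\<close> with
  \<open>i < count B I\<close> enumerate the bars with multiplicity.
\<close>

definition interval_sum :: "bar multiset \<Rightarrow> (bar \<times> nat \<Rightarrow> bit) pmodule" where
  "interval_sum B =
    \<lparr>space_at = (\<lambda>t. free_space {(I, i). i < count B I \<and> alive t I}),
     shift = (\<lambda>s t c p. if alive t (fst p) then c p else 0)\<rparr>"

definition barcode_of :: "bar multiset \<Rightarrow> 'b pmodule \<Rightarrow> bool" where
  "barcode_of B M \<longleftrightarrow> barcode B \<and> pmodule_iso M (interval_sum B)"

definition bars_close :: "real \<Rightarrow> bar \<Rightarrow> bar \<Rightarrow> bool" where
  "bars_close \<delta> I J \<longleftrightarrow>
     \<bar>fst I - fst J\<bar> \<le> \<delta> \<and> snd I \<le> snd J + ereal \<delta> \<and> snd J \<le> snd I + ereal \<delta>"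

text \<open>
  A \<open>\<delta>\<close>-matching pairs up the bars in \<open>B1\<close> with those in \<open>C1\<close>, moving endpoints by at most \<open>\<delta>\<close>,
  and leaves those in \<open>B2\<close> and \<open>C2\<close> unmatched.
\<close>

definition matching :: "real \<Rightarrow> bar multiset \<Rightarrow> bar multiset \<Rightarrow> bool" where
  "matching \<delta> B C \<longleftrightarrow> (\<exists>B1 B2 C1 C2. B = B1 + B2 \<and> C = C1 + C2 \<and>
     rel_mset (bars_close \<delta>) B1 C1 \<and>
     (\<forall>I\<in>#B2 + C2. snd I \<le> ereal (fst I) + ereal (2 * \<delta>)))"

definition bottleneck_dist :: "bar multiset \<Rightarrow> bar multiset \<Rightarrow> ereal" where
  "bottleneck_dist B C = (INF \<delta>\<in>{\<delta>. 0 \<le> \<delta> \<and> matching \<delta> B C}. ereal \<delta>)"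


section \<open>Vietoris--Rips complexes\<close>

definition diam_le :: "('a \<Rightarrow> 'a \<Rightarrow> real) \<Rightarrow> 'a set \<Rightarrow> real \<Rightarrow> bool" where
  "diam_le d S r \<longleftrightarrow> (\<forall>x\<in>S. \<forall>y\<in>S. d x y \<le> r)"

definition vietoris_rips :: "'a set \<Rightarrow> ('a \<Rightarrow> 'a \<Rightarrow> real) \<Rightarrow> real \<Rightarrow> 'a set set" where
  "vietoris_rips X d t = {\<sigma>. \<sigma> \<subseteq> X \<and> finite \<sigma> \<and> \<sigma> \<noteq> {} \<and> diam_le d \<sigma> (2 * t)}"

definition vr_homology ::
    "'a set \<Rightarrow> ('a \<Rightarrow> 'a \<Rightarrow> real) \<Rightarrow> nat \<Rightarrow> ('a set \<Rightarrow> bit) set pmodule" where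
  "vr_homology X d k =
    \<lparr>space_at = (\<lambda>t. homology (vietoris_rips X d t) k),
     shift = (\<lambda>s t. homology_inclusion (vietoris_rips X d t) k)\<rparr>"


section \<open>Model of computation\<close>

text \<open>
  Algorithms are programs of a real RAM with a distance oracle. The machine has registers and
  zero-initialised arrays holding integers (words), and registers and arrays holding exact real
  numbers. It computes with words by \<open>+\<close>, truncated \<open>-\<close>, \<open>*\<close>, \<open>div\<close> and \<open>mod\<close>, and with reals by the
  field operations and comparisons. Words can be used as addresses and can be converted to reals,
  but not conversely: there is no rounding. A program mentions only finitely many registers and
  arrays, hence the arrays could be interleaved in a single linear memory.
\<close>

datatype iexp =
    ICon nat
  | IVar nat
  | IGet nat iexp  \<comment> \<open>array name and address\<close>
  | IAdd iexp iexp
  | ISub iexp iexp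
  | IMul iexp iexp
  | IDiv iexp iexp
  | IMod iexp iexp

datatype rexp =
    RVar nat
  | RGet nat iexp
  | RInt iexp
  | RAdd rexp rexp
  | RSub rexp rexp
  | RMul rexp rexp
  | RDiv rexp rexp
  | Dist iexp iexp  \<comment> \<open>oracle query for the distance of two points\<close>

datatype test = ILess iexp iexp | RLess rexp rexp

datatype com =
    Skip
  | ISet nat iexp
  | IPut nat iexp iexp  \<comment> \<open>array name, address, value\<close>
  | RSet nat rexp
  | RPut nat iexp rexp
  | Seq com com
  | Cond test com com
  | While test com

record state =
  ivar :: "nat \<Rightarrow> nat"
  rvar :: "nat \<Rightarrow> real"
  iarr :: "nat \<Rightarrow> nat \<Rightarrow> nat"
  rarr :: "nat \<Rightarrow> nat \<Rightarrow> real"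

fun ival :: "state \<Rightarrow> iexp \<Rightarrow> nat" where
  "ival s (ICon c) = c"
| "ival s (IVar x) = ivar s x"
| "ival s (IGet a e) = iarr s a (ival s e)"
| "ival s (IAdd e f) = ival s e + ival s f"
| "ival s (ISub e f) = ival s e - ival s f"
| "ival s (IMul e f) = ival s e * ival s f"
| "ival s (IDiv e f) = ival s e div ival s f"
| "ival s (IMod e f) = ival s e mod ival s f"

fun rval :: "(nat \<Rightarrow> nat \<Rightarrow> real) \<Rightarrow> state \<Rightarrow> rexp \<Rightarrow> real" where
  "rval d s (RVar x) = rvar s x"
| "rval d s (RGet a e) = rarr s a (ival s e)"
| "rval d s (RInt e) = real (ival s e)"
| "rval d s (RAdd e f) = rval d s e + rval d s f"
| "rval d s (RSub e f) = rval d s e - rval d s f"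
| "rval d s (RMul e f) = rval d s e * rval d s f"
| "rval d s (RDiv e f) = rval d s e / rval d s f"
| "rval d s (Dist e f) = d (ival s e) (ival s f)"

fun holds :: "(nat \<Rightarrow> nat \<Rightarrow> real) \<Rightarrow> state \<Rightarrow> test \<Rightarrow> bool" where
  "holds d s (ILess e f) \<longleftrightarrow> ival s e < ival s f"
| "holds d s (RLess e f) \<longleftrightarrow> rval d s e < rval d s f"

text \<open>
  An expression may be evaluated only if all intermediate words are at most the largest word \<open>W\<close>,
  and if the oracle is queried only for points below \<open>n\<close>. Otherwise the program gets stuck.
\<close>

fun iok :: "nat \<Rightarrow> state \<Rightarrow> iexp \<Rightarrow> bool" where
  "iok W s (ICon c) \<longleftrightarrow> c \<le> W"
| "iok W s (IVar x) \<longleftrightarrow> True"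
| "iok W s (IGet a e) \<longleftrightarrow> iok W s e"
| "iok W s (IAdd e f) \<longleftrightarrow> iok W s e \<and> iok W s f \<and> ival s e + ival s f \<le> W"
| "iok W s (ISub e f) \<longleftrightarrow> iok W s e \<and> iok W s f"
| "iok W s (IMul e f) \<longleftrightarrow> iok W s e \<and> iok W s f \<and> ival s e * ival s f \<le> W"
| "iok W s (IDiv e f) \<longleftrightarrow> iok W s e \<and> iok W s f"
| "iok W s (IMod e f) \<longleftrightarrow> iok W s e \<and> iok W s f"

fun rok :: "nat \<Rightarrow> nat \<Rightarrow> state \<Rightarrow> rexp \<Rightarrow> bool" where
  "rok W n s (RVar x) \<longleftrightarrow> True"
| "rok W n s (RGet a e) \<longleftrightarrow> iok W s e"
| "rok W n s (RInt e) \<longleftrightarrow> iok W s e"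
| "rok W n s (RAdd e f) \<longleftrightarrow> rok W n s e \<and> rok W n s f"
| "rok W n s (RSub e f) \<longleftrightarrow> rok W n s e \<and> rok W n s f"
| "rok W n s (RMul e f) \<longleftrightarrow> rok W n s e \<and> rok W n s f"
| "rok W n s (RDiv e f) \<longleftrightarrow> rok W n s e \<and> rok W n s f"
| "rok W n s (Dist e f) \<longleftrightarrow> iok W s e \<and> iok W s f \<and> ival s e < n \<and> ival s f < n"

fun test_ok :: "nat \<Rightarrow> nat \<Rightarrow> state \<Rightarrow> test \<Rightarrow> bool" where
  "test_ok W n s (ILess e f) \<longleftrightarrow> iok W s e \<and> iok W s f"
| "test_ok W n s (RLess e f) \<longleftrightarrow> rok W n s e \<and> rok W n s f"

text \<open>
  \<open>exec W n d c s t s'\<close>: with largest word \<open>W\<close> and distance oracle \<open>d\<close> on the points below \<open>n\<close>,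
  program \<open>c\<close> started in \<open>s\<close> halts in \<open>s'\<close> after time \<open>t\<close>. Every assignment and every test takes
  unit time: the size of the expressions in a fixed program is bounded, so charging for each
  operation and oracle query would change running times by a constant factor only.
\<close>

inductive exec ::
    "nat \<Rightarrow> nat \<Rightarrow> (nat \<Rightarrow> nat \<Rightarrow> real) \<Rightarrow> com \<Rightarrow> state \<Rightarrow> nat \<Rightarrow> state \<Rightarrow> bool"
  for W :: nat and n :: nat and d :: "nat \<Rightarrow> nat \<Rightarrow> real" where
  exec_Skip: "exec W n d Skip s 1 s"
| exec_ISet: "iok W s e \<Longrightarrow>
    exec W n d (ISet x e) s 1 (s\<lparr>ivar := (ivar s)(x := ival s e)\<rparr>)"
| exec_IPut: "iok W s i \<Longrightarrow> iok W s e \<Longrightarrow>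
    exec W n d (IPut a i e) s 1
      (s\<lparr>iarr := (iarr s)(a := (iarr s a)(ival s i := ival s e))\<rparr>)"
| exec_RSet: "rok W n s e \<Longrightarrow>
    exec W n d (RSet x e) s 1 (s\<lparr>rvar := (rvar s)(x := rval d s e)\<rparr>)"
| exec_RPut: "iok W s i \<Longrightarrow> rok W n s e \<Longrightarrow>
    exec W n d (RPut a i e) s 1
      (s\<lparr>rarr := (rarr s)(a := (rarr s a)(ival s i := rval d s e))\<rparr>)"
| exec_Seq: "exec W n d c s t s' \<Longrightarrow> exec W n d c' s' t' s'' \<Longrightarrow>
    exec W n d (Seq c c') s (t + t') s''"
| exec_Cond_True: "test_ok W n s b \<Longrightarrow> holds d s b \<Longrightarrow> exec W n d c s t s' \<Longrightarrow>
    exec W n d (Cond b c c') s (1 + t) s'"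
| exec_Cond_False: "test_ok W n s b \<Longrightarrow> \<not> holds d s b \<Longrightarrow> exec W n d c' s t s' \<Longrightarrow>
    exec W n d (Cond b c c') s (1 + t) s'"
| exec_While_False: "test_ok W n s b \<Longrightarrow> \<not> holds d s b \<Longrightarrow>
    exec W n d (While b c) s 1 s"
| exec_While_True: "test_ok W n s b \<Longrightarrow> holds d s b \<Longrightarrow> exec W n d c s t s' \<Longrightarrow>
    exec W n d (While b c) s' t' s'' \<Longrightarrow>
    exec W n d (While b c) s (1 + t + t') s''"

definition zero_state :: state where
  "zero_state =
    \<lparr>ivar = (\<lambda>_. 0), rvar = (\<lambda>_. 0), iarr = (\<lambda>_ _. 0), rarr = (\<lambda>_ _. 0)\<rparr>"


section \<open>The two computational problems\<close>

text \<open>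
  Input of the barcode algorithm: the number of points in word register \<open>0\<close>; the distances are
  available through the oracle only. Output: the number of bars in word register \<open>0\<close>, their left
  endpoints in real array \<open>0\<close> and their right endpoints in real array \<open>1\<close>. In positive degrees a
  finite metric space has finite bars only, hence so does every barcode at finite distance, and
  no encoding of infinite endpoints is required.
\<close>

definition metric_input :: "nat \<Rightarrow> state" where
  "metric_input n = zero_state\<lparr>ivar := (\<lambda>_. 0)(0 := n)\<rparr>"

definition output_bars :: "state \<Rightarrow> bar multiset" where
  "output_bars s = image_mset (\<lambda>i. (rarr s 0 i, ereal (rarr s 1 i))) (mset_set {..<ivar s 0})"

text \<open>
  \<open>T\<close> bounds the running time in terms of the number of points. The points of a finite metric
  space with \<open>n\<close> points are numbered \<open>0, \<dots>, n - 1\<close>. Words consist of \<open>O(log n)\<close> bits, i.e. the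
  largest word is polynomial in \<open>n\<close>.
\<close>

definition approximates_vr_barcode :: "nat \<Rightarrow> real \<Rightarrow> com \<Rightarrow> (nat \<Rightarrow> nat) \<Rightarrow> bool" where
  "approximates_vr_barcode k \<epsilon> A T \<longleftrightarrow> (\<exists>w. \<forall>n d.
     Metric_space {..<n} d \<longrightarrow> diam_le d {..<n} 1 \<longrightarrow>
     (\<exists>t s. exec ((n + 2) ^ w) n d A (metric_input n) t s \<and> t \<le> T n \<and>
        barcode (output_bars s) \<and>
        (\<exists>B. barcode_of B (vr_homology {..<n} d k) \<and>
           bottleneck_dist (output_bars s) B \<le> ereal \<epsilon>)))"

text \<open>
  Input of the rank algorithm: the number \<open>m\<close> of nonzero entries and the numbers of rows and
  columns of the matrix in word registers \<open>0\<close>, \<open>1\<close>, \<open>2\<close>, and the row and column indices of the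
  nonzero entries, listed in any order and without repetition, in word arrays \<open>0\<close> and \<open>1\<close>.
\<close>

definition matrix_input :: "nat \<Rightarrow> nat \<Rightarrow> (nat \<times> nat) list \<Rightarrow> state" where
  "matrix_input nr nc es = zero_state
    \<lparr>ivar := (\<lambda>_. 0)(0 := length es, 1 := nr, 2 := nc),
     iarr := (\<lambda>_ _. 0)
       (0 := (\<lambda>i. if i < length es then fst (es ! i) else 0),
        1 := (\<lambda>i. if i < length es then snd (es ! i) else 0))\<rparr>"

definition lists_entries :: "(nat \<times> nat) list \<Rightarrow> bit mat \<Rightarrow> bool" where
  "lists_entries es M \<longleftrightarrow> distinct es \<and>
     set es = {(i, j). i < dim_row M \<and> j < dim_col M \<and> M $$ (i, j) \<noteq> 0}"

text \<open>
  \<open>T\<close> bounds the running time in terms of the number of nonzero entries. The rank is to be left in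
  word register \<open>0\<close>. No oracle is available: with no points every query gets stuck. Words consist
  of \<open>O(log (m + nr + nc))\<close> bits, which is enough to hold the input.
\<close>

definition computes_rank :: "com \<Rightarrow> (nat \<Rightarrow> nat) \<Rightarrow> bool" where
  "computes_rank P T \<longleftrightarrow> (\<exists>w. \<forall>nr nc (M :: bit mat) es.
     M \<in> carrier_mat nr nc \<longrightarrow> lists_entries es M \<longrightarrow>
     (\<exists>t s. exec ((length es + nr + nc + 2) ^ w) 0 (\<lambda>_ _. 0) P (matrix_input nr nc es) t s \<and>
        t \<le> T (length es) \<and> ivar s 0 = vec_space.rank nr M))"

end

theory Submission
  imports Defs
begin

text \<open>
  The rank of \<open>M\<close> is read off \<open>H\<^sub>2\<close> of the clique complex of a tripartite graph. Every nonzero row is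
  represented by a circle, made of two poles and two arcs between them (each subdivided by a midpoint),
  and every nonzero column by a sphere with one hole for each of its entries, whose boundary circles
  are the circles of the rows. Such a sphere consists of a front and a back disc. Both are cones over
  cycles that run alternately through one of the two arcs of a row circle and through a seam leading to
  the next row of the column; the two discs share the seams. A 2-cycle contains either all or none of
  a sphere, and the chosen spheres must meet every row circle an even number of times. So the
  2-cycles form the kernel of \<open>M\<close> on the nonzero columns, and the second Betti number is the number of
  nonzero columns minus the rank.

  Adjacent points get the distance \<open>1/2\<close>, and all other pairs the distance \<open>1\<close>. The complex is then
  constant for \<open>1/4 \<le> t < 1/2\<close> and discrete before, so the bars born before \<open>1/2\<close> are born at \<open>1/4\<close>
  and have length at least \<open>1/4\<close>; they can be counted in any \<open>\<epsilon>\<close>-approximation with \<open>\<epsilon> < 1/16\<close>. Points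
  are allocated per nonzero entry, seven for each, with the points of a row or column
  sitting at its last entry. Unused points are isolated and do no harm in degree 2.
\<close>

section \<open>Null vectors of sparse matrices over the field with two elements\<close>

declare add_bit_eq_xor [simp del] mult_bit_eq_and [simp del]

lemma UNIV_bit: "(UNIV :: bit set) = {0, 1}"
  using bit.exhaust by auto

lemma bit_add_self [simp]: "a + a = (0 :: bit)"
  by (cases a) simp_all

lemma bit_add_eq_0_iff: "a + b = 0 \<longleftrightarrow> a = (b :: bit)"
  by (cases a; cases b) simp_all

text \<open>Coordinates in a finite basis identify vectors with functions from the basis to the
  field. Over a finite field the cardinality thus determines the dimension, and all dimensions below
  are compared by counting.\<close>

lemma (in vectorspace) card_carrier_eq:
  assumes "fin_dim"
  shows "card (carrier V) = card (carrier K) ^ dim"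
proof -
  obtain B where B: "finite B" "basis B"
    using finite_basis_exists [OF assms] by blast
  hence BV: "B \<subseteq> carrier V" by (simp add: basis_def)
  have crit: "\<forall>v. v \<in> carrier V \<longrightarrow> (\<exists>!a. a \<in> B \<rightarrow>\<^sub>E carrier K \<and> lincomb a B = v)"
    using basis_criterion [OF B(1) BV] B(2) by blast
  have "bij_betw (\<lambda>a. lincomb a B) (B \<rightarrow>\<^sub>E carrier K) (carrier V)"
    unfolding bij_betw_def
  proof
    have L: "lincomb a B \<in> carrier V" if "a \<in> B \<rightarrow>\<^sub>E carrier K" for a
      using that BV by (intro lincomb_closed) auto
    show "inj_on (\<lambda>a. lincomb a B) (B \<rightarrow>\<^sub>E carrier K)"
      using crit L by (intro inj_onI) metis
    show "(\<lambda>a. lincomb a B) ` (B \<rightarrow>\<^sub>E carrier K) = carrier V"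
    proof (intro equalityI subsetI)
      fix v assume "v \<in> carrier V"
      then obtain a where "a \<in> B \<rightarrow>\<^sub>E carrier K" "lincomb a B = v" using crit by blast
      thus "v \<in> (\<lambda>a. lincomb a B) ` (B \<rightarrow>\<^sub>E carrier K)" by blast
    qed (use L in blast)
  qed
  hence "card (carrier V) = card (B \<rightarrow>\<^sub>E carrier K)" by (simp add: bij_betw_same_card)
  also have "\<dots> = card (carrier K) ^ card B" using B(1) by (simp add: card_funcsetE)
  finally show ?thesis using dim_basis [OF B] by simp
qed

text \<open>The image is the column space, whose dimension is the rank.\<close>

lemma card_mult_mat_vec_image:
  assumes "(A :: bit mat) \<in> carrier_mat nr nc"
  shows "card ((\<lambda>v. A *\<^sub>v v) ` carrier_vec nc) = 2 ^ vec_space.rank nr A"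
proof -
  interpret vec_space "TYPE(bit)" nr .
  let ?S = "set (cols A)"
  have S: "?S \<subseteq> carrier V" using assms cols_dim by fastforce
  interpret W: vectorspace class_ring "span_vs ?S"
    using S span_is_subspace subspace_def subspace_is_vs by simp
  have "card (carrier (span_vs ?S)) = card (carrier (class_ring :: bit ring)) ^ W.dim"
    by (rule W.card_carrier_eq) (use fin_dim_span_cols [OF assms] in simp)
  moreover have "carrier (span_vs ?S) = (\<lambda>v. A *\<^sub>v v) ` carrier_vec nc"
    using col_space_eq [OF assms] assms unfolding col_space_def
    by (auto intro!: mult_mat_vec_carrier)
  moreover have "card (UNIV :: bit set) = 2" by (simp add: UNIV_bit)
  ultimately show ?thesis by (simp add: rank_def)
qed

lemma card_fibres:
  assumes "finite A" "\<And>y. y \<in> f ` A \<Longrightarrow> card {x \<in> A. f x = y} = k"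
  shows "card A = k * card (f ` A)"
  using sum.image_gen [OF assms(1), of "\<lambda>_. 1 :: nat" f] assms(2) by simp

text \<open>Rank-nullity by counting: each nonempty fibre is a translate of the kernel. Additivity
  is phrased through equality of values, so that the codomain can be a bare type.\<close>

lemma card_additive_kernel:
  fixes f :: "('i \<Rightarrow> bit) \<Rightarrow> 'b"
  assumes fin: "finite C"
    and add: "\<And>u v. f u = f v \<longleftrightarrow> f (\<lambda>i. u i + v i) = f (\<lambda>_. 0)"
  defines "F \<equiv> {u :: 'i \<Rightarrow> bit. \<forall>i. i \<notin> C \<longrightarrow> u i = 0}"
  shows "2 ^ card C = card {u \<in> F. f u = f (\<lambda>_. 0)} * card (f ` F)"
proof -
  have bij: "bij_betw (\<lambda>U i. if i \<in> U then 1 else 0 :: bit) (Pow C) F"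
    by (rule bij_betw_byWitness [where f' = "\<lambda>u. {i. u i \<noteq> 0}"]) (auto simp: F_def)
  have finF: "finite F" using bij fin bij_betw_finite by blast
  have "card F = 2 ^ card C" using bij fin by (simp add: card_Pow bij_betw_same_card [symmetric])
  moreover have "card F = card {u \<in> F. f u = f (\<lambda>_. 0)} * card (f ` F)"
  proof (rule card_fibres [OF finF])
    fix y assume "y \<in> f ` F"
    then obtain w where w: "w \<in> F" "y = f w" by blast
    have tr: "f (\<lambda>i. u i + w i) = f (\<lambda>_. 0) \<longleftrightarrow> f u = y" for u
      using add [of u w] w by simp
    \<comment> \<open>Translation by \<open>w\<close> is its own inverse in characteristic
      2.\<close>
    have "bij_betw (\<lambda>u i. u i + w i) {u \<in> F. f u = y} {u \<in> F. f u = f (\<lambda>_. 0)}"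
      by (rule bij_betw_byWitness [where f' = "\<lambda>u i. u i + w i"])
        (use w(1) tr tr [of "\<lambda>i. _ i + w i"] in \<open>auto simp: F_def add.assoc\<close>)
    thus "card {u \<in> F. f u = y} = card {u \<in> F. f u = f (\<lambda>_. 0)}" by (rule bij_betw_same_card)
  qed
  ultimately show ?thesis by simp
qed

text \<open>This models an array during a loop, with initial contents \<open>a\<close>, so that the
  state of the program after each iteration can be written down verbatim.\<close>

primrec latest :: "(nat \<Rightarrow> nat) \<Rightarrow> (nat \<Rightarrow> nat) \<Rightarrow> nat \<Rightarrow> nat \<Rightarrow> nat" where
  "latest f a 0 = a"
| "latest f a (Suc e) = (latest f a e)(f e := e)"

lemma latest_cases:
  obtains "\<And>k. k < e \<Longrightarrow> f k \<noteq> j" "latest f a e j = a j"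
  | "latest f a e j < e" "f (latest f a e j) = j" "\<And>k. k < e \<Longrightarrow> f k = j \<Longrightarrow> k \<le> latest f a e j"
proof (induction e arbitrary: thesis)
  case 0
  show ?case by (rule 0) simp_all
next
  case (Suc e)
  show ?case
  proof (cases "f e = j")
    case True
    show ?thesis by (rule Suc.prems(2)) (use True in auto)
  next
    case False
    show ?thesis
    proof (rule Suc.IH)
      assume *: "\<And>k. k < e \<Longrightarrow> f k \<noteq> j" "latest f a e j = a j"
      show thesis by (rule Suc.prems(1)) (use * False in \<open>auto simp: less_Suc_eq\<close>)
    next
      assume *: "latest f a e j < e" "f (latest f a e j) = j"
        "\<And>k. k < e \<Longrightarrow> f k = j \<Longrightarrow> k \<le> latest f a e j"
      show thesis by (rule Suc.prems(2)) (use * False in \<open>auto simp: less_Suc_eq\<close>)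
    qed
  qed
qed

text \<open>A canonical representative of the entries that share a row or column index. One pass
  over the entries finds it, without sorting and without a pass over the indices, whose number is
  not bounded in terms of \<open>m\<close>.\<close>

definition rep :: "nat \<Rightarrow> (nat \<Rightarrow> nat) \<Rightarrow> nat \<Rightarrow> nat" where
  "rep m f e = latest f (\<lambda>_. 0) m (f e)"

lemma rep:
  assumes "e < m"
  shows "rep m f e < m" "f (rep m f e) = f e" "e \<le> rep m f e"
  by (cases rule: latest_cases [where e = m and f = f and j = "f e" and a = "\<lambda>_. 0"];
      use assms in \<open>auto simp: rep_def\<close>)+

lemma rep_eq_iff:
  assumes "e < m" "e' < m"
  shows "rep m f e = rep m f e' \<longleftrightarrow> f e = f e'"
  by (metis assms rep(2) rep_def)

section \<open>Nullity of the nonzero columns\<close>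

text \<open>
  A vector indexed by the nonzero columns is a function supported on the set \<open>c ` {..<m}\<close> of entries
  that represent a column.
\<close>

definition null_vectors :: "nat \<Rightarrow> (nat \<Rightarrow> nat) \<Rightarrow> (nat \<Rightarrow> nat) \<Rightarrow> (nat \<Rightarrow> bit) set" where
  "null_vectors m r c = {u. (\<forall>i. i \<notin> c ` {..<m} \<longrightarrow> u i = 0) \<and>
     (\<forall>e<m. (\<Sum>e' | e' < m \<and> r e' = r e. u (c e')) = 0)}"

text \<open>Rank-nullity for the submatrix of the nonzero columns. Its image is the whole column
  space, because zero columns contribute nothing.\<close>

lemma card_null_vectors:
  fixes M :: "bit mat" and r cl :: "nat \<Rightarrow> nat"
  assumes M: "M \<in> carrier_mat nr nc" and es: "lists_entries es M"
    and nth_es: "\<And>e. e < length es \<Longrightarrow> es ! e = (r e, cl e)"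
  defines "m \<equiv> length es" and "c \<equiv> rep (length es) cl"
  shows "2 ^ card (c ` {..<m}) = card (null_vectors m r c) * 2 ^ vec_space.rank nr M"
proof -
  have ceq: "c = rep m cl" by (simp add: c_def m_def)
  have set_es: "set es = {(i, j). i < nr \<and> j < nc \<and> M $$ (i, j) \<noteq> 0}" and dist: "distinct es"
    using es M unfolding lists_entries_def by auto
  have entry: "r e < nr" "cl e < nc" if "e < m" for e
  proof -
    have "(r e, cl e) \<in> set es" using that nth_es [of e] nth_mem [of e es] by (simp add: m_def)
    thus "r e < nr" "cl e < nc" unfolding set_es by simp_all
  qed
  \<comment> \<open>\<open>f\<close> is multiplication by \<open>M\<close> in coordinates placed at
    the column representatives.\<close>
  define f where "f u = vec nr (\<lambda>i. \<Sum>e | e < m \<and> r e = i. u (c e))" for u :: "nat \<Rightarrow> bit"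
  define F where "F = {u :: nat \<Rightarrow> bit. \<forall>i. i \<notin> c ` {..<m} \<longrightarrow> u i = 0}"
  have f_eq: "f u = f v \<longleftrightarrow> (\<forall>i<nr. (\<Sum>e | e < m \<and> r e = i. u (c e)) = (\<Sum>e | e < m \<and> r e = i. v (c e)))"
    for u v by (simp add: f_def vec_eq_iff)
  have f_add: "f u = f v \<longleftrightarrow> f (\<lambda>i. u i + v i) = f (\<lambda>_. 0)" for u v
    by (simp add: f_eq sum.distrib bit_add_eq_0_iff)
  \<comment> \<open>Rows without entries impose no condition, which is why
    \<open>null_vectors\<close> can quantify over entries instead of rows.\<close>
  have zero_rows: "(\<Sum>e | e < m \<and> r e = i. u (c e)) = 0" if "\<forall>e<m. r e \<noteq> i" for i u
    using that by (auto intro!: sum.neutral)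
  have "(\<forall>i<nr. (\<Sum>e | e < m \<and> r e = i. u (c e)) = 0) \<longleftrightarrow>
      (\<forall>e<m. (\<Sum>e' | e' < m \<and> r e' = r e. u (c e')) = 0)" for u
  proof (intro iffI allI impI)
    fix i assume R: "\<forall>e<m. (\<Sum>e' | e' < m \<and> r e' = r e. u (c e')) = 0"
    show "(\<Sum>e | e < m \<and> r e = i. u (c e)) = 0"
    proof (cases "\<exists>e<m. r e = i")
      case True
      thus ?thesis using R by blast
    next
      case False
      thus ?thesis using zero_rows [of i u] by blast
    qed
  next
    fix e assume *: "\<forall>i<nr. (\<Sum>e | e < m \<and> r e = i. u (c e)) = 0" and "e < m"
    thus "(\<Sum>e' | e' < m \<and> r e' = r e. u (c e')) = 0" using entry(1) [of e] by blast
  qed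
  hence "{u \<in> F. f u = f (\<lambda>_. 0)} = null_vectors m r c"
    by (auto simp: null_vectors_def F_def f_eq)
  moreover have "f ` F = (\<lambda>v. M *\<^sub>v v) ` carrier_vec nc"
  proof -
    have bij: "bij_betw (\<lambda>e. es ! e) {e. e < m \<and> r e = i} {(i', j). i' = i \<and> j < nc \<and> M $$ (i, j) \<noteq> 0}"
      if "i < nr" for i
    proof -
      have "bij_betw (\<lambda>e. es ! e) {..<m} (set es)"
        by (rule bij_betw_nth) (simp_all add: dist m_def)
      moreover have "(\<lambda>e. es ! e) ` {e \<in> {..<m}. r e = i} = {p \<in> set es. fst p = i}"
        unfolding m_def set_conv_nth by (force simp: nth_es)
      ultimately have "bij_betw (\<lambda>e. es ! e) {e \<in> {..<m}. r e = i} {p \<in> set es. fst p = i}"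
        by (intro bij_betw_subset [where B = "{e \<in> {..<m}. r e = i}"]) auto
      moreover have "{p \<in> set es. fst p = i} = {(i', j). i' = i \<and> j < nc \<and> M $$ (i, j) \<noteq> 0}"
        unfolding set_es using that by auto
      ultimately show ?thesis by simp
    qed
    have mult: "M *\<^sub>v v = vec nr (\<lambda>i. \<Sum>e | e < m \<and> r e = i. v $ cl e)"
      if "v \<in> carrier_vec nc" for v
    proof (rule eq_vecI)
      fix i assume "i < dim_vec (vec nr (\<lambda>i. \<Sum>e | e < m \<and> r e = i. v $ cl e))"
      hence i: "i < nr" by simp
      have "(M *\<^sub>v v) $ i = (\<Sum>j = 0..<nc. M $$ (i, j) * v $ j)"
        using that M i by (simp add: scalar_prod_def)
      also have "\<dots> = (\<Sum>j | j < nc \<and> M $$ (i, j) \<noteq> 0. v $ j)"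
        by (rule sum.mono_neutral_cong_right) auto
      also have "\<dots> = (\<Sum>p \<in> {(i', j). i' = i \<and> j < nc \<and> M $$ (i, j) \<noteq> 0}. v $ snd p)"
        by (rule sum.reindex_bij_witness [where i = snd and j = "\<lambda>j. (i, j)"]) auto
      also have "\<dots> = (\<Sum>e | e < m \<and> r e = i. v $ cl e)"
        using sum.reindex_bij_betw [OF bij [OF i], of "\<lambda>p. v $ snd p"] by (simp add: nth_es m_def)
      finally show "(M *\<^sub>v v) $ i = vec nr (\<lambda>i. \<Sum>e | e < m \<and> r e = i. v $ cl e) $ i"
        using i by simp
    qed (use M in simp)
    show ?thesis
    proof (intro equalityI subsetI; elim imageE; hypsubst)
      fix u assume "u \<in> F"
      \<comment> \<open>For an empty column \<open>latest\<close> returns its default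
        \<open>0\<close>. The resulting coordinate \<open>u 0\<close> is harmless, since it only
        meets zero entries of \<open>M\<close>.\<close>
      have "f u = M *\<^sub>v vec nc (\<lambda>j. u (latest cl (\<lambda>_. 0) m j))"
        by (subst mult) (use entry in \<open>auto simp: f_def ceq rep_def intro!: sum.cong\<close>)
      thus "f u \<in> (\<lambda>v. M *\<^sub>v v) ` carrier_vec nc" by auto
    next
      fix v :: "bit vec" assume v: "v \<in> carrier_vec nc"
      let ?u = "\<lambda>k. if k \<in> c ` {..<m} then v $ cl k else 0"
      have "M *\<^sub>v v = f ?u"
        unfolding mult [OF v] f_def
      proof (intro arg_cong [of _ _ "vec nr"] ext sum.cong refl)
        fix i e assume "e \<in> {e. e < m \<and> r e = i}"
        thus "v $ cl e = ?u (c e)" using rep(2) [of e m cl] by (simp add: ceq)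
      qed
      moreover have "?u \<in> F" by (simp add: F_def)
      ultimately show "M *\<^sub>v v \<in> f ` F" by blast
    qed
  qed
  ultimately show ?thesis
    using card_additive_kernel [of "c ` {..<m}" f, OF _ f_add, folded F_def]
      card_mult_mat_vec_image [OF M] by simp
qed

section \<open>Barcodes of filtrations that are constant on an interval\<close>

lemma card_free_space:
  assumes "finite S"
  shows "card (carrier (free_space S)) = 2 ^ card S"
proof -
  have "bij_betw (\<lambda>U i. if i \<in> U then 1 else 0 :: bit) (Pow S) (carrier (free_space S))"
    by (rule bij_betw_byWitness [where f' = "\<lambda>c. {i. c i \<noteq> 0}"])
      (use assms in \<open>auto simp: free_space_def finite_subset split: if_splits\<close>)
  thus ?thesis using assms by (simp add: card_Pow bij_betw_same_card [symmetric])
qed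

lemma homology_carrier:
  "carrier (homology K k) = (\<lambda>z. (\<lambda>b i. b i + z i) ` boundaries K k) ` cycles K k"
  by (auto simp: homology_def quotient_space_def chains_def free_space_def A_RCOSETS_def RCOSETS_def
      r_coset_def)

lemma zero_in_cycles: "(\<lambda>_. 0) \<in> cycles K k"
  by (simp add: cycles_def chains_def free_space_def boundary_def fun_eq_iff)

lemma boundaries_no_simplices:
  assumes "simplices K (k + 1) = {}"
  shows "boundaries K k = {\<lambda>_. 0}"
proof -
  have "carrier (chains K (k + 1)) = {\<lambda>_. 0}"
    unfolding chains_def assms by (auto simp: free_space_def)
  thus ?thesis by (simp add: boundaries_def boundary_def fun_eq_iff)
qed

lemma homology_carrier_no_simplices:
  assumes "simplices K (k + 1) = {}"
  shows "carrier (homology K k) = (\<lambda>z. {z}) ` cycles K k"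
  by (simp add: homology_carrier boundaries_no_simplices [OF assms])

text \<open>Adding the zero group of boundaries leaves a coset as it is.\<close>

lemma homology_inclusion_no_simplices:
  assumes "simplices L (k + 1) = {}"
  shows "homology_inclusion L k S = S"
  by (auto simp: homology_inclusion_def boundaries_no_simplices [OF assms] set_add_def set_mult_def
      chains_def free_space_def)

lemma homology_trivial:
  assumes "simplices K k = {}"
  shows "\<exists>x. carrier (homology K k) = {x}"
proof -
  have "cycles K k \<subseteq> {\<lambda>_. 0}"
    unfolding cycles_def chains_def assms by (auto simp: free_space_def)
  hence "cycles K k = {\<lambda>_. 0}" using zero_in_cycles by blast
  thus ?thesis by (simp add: homology_carrier)
qed

text \<open>No bar is alive before \<open>a\<close>, where the module is trivial. On
  \<open>[a, b)\<close> the structure maps are identities, so bars neither appear nor vanish there,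
  and the bars alive at \<open>a\<close> index a basis of \<open>V\<close>.\<close>

lemma barcode_of_constant_on_interval:
  assumes B: "barcode_of B M" and ab: "0 \<le> a" "a < b"
    and triv: "\<And>t. 0 \<le> t \<Longrightarrow> t < a \<Longrightarrow> \<exists>x. carrier (space_at M t) = {x}"
    and const: "\<And>t. a \<le> t \<Longrightarrow> t < b \<Longrightarrow> carrier (space_at M t) = V"
    and shift: "\<And>s t x. a \<le> s \<Longrightarrow> s \<le> t \<Longrightarrow> t < b \<Longrightarrow> x \<in> V \<Longrightarrow> shift M s t x = x"
  shows "\<And>I. I \<in># B \<Longrightarrow> fst I < b \<Longrightarrow> fst I = a \<and> ereal b \<le> snd I"
    and "card V = 2 ^ size {#I \<in># B. fst I < b#}"
proof -
  have bc: "barcode B" using B by (simp add: barcode_of_def)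
  define S where "S t = {(I, i). i < count B I \<and> alive t I}" for t
  define d where "d p = (\<lambda>q. if q = p then 1 else 0 :: bit)" for p :: "bar \<times> nat"
  obtain \<psi> where "\<forall>t\<ge>0. bij_betw (\<psi> t) (carrier (space_at M t)) (carrier (space_at (interval_sum B) t))"
    and "\<forall>s t. 0 \<le> s \<longrightarrow> s \<le> t \<longrightarrow> (\<forall>x\<in>carrier (space_at M s).
      \<psi> t (shift M s t x) = shift (interval_sum B) s t (\<psi> s x))"
    using B unfolding barcode_of_def pmodule_iso_def by blast
  hence bij: "\<And>t. 0 \<le> t \<Longrightarrow> bij_betw (\<psi> t) (carrier (space_at M t)) (carrier (free_space (S t)))"
    and nat: "\<And>s t x. 0 \<le> s \<Longrightarrow> s \<le> t \<Longrightarrow> x \<in> carrier (space_at M s) \<Longrightarrow>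
      \<psi> t (shift M s t x) = (\<lambda>p. if alive t (fst p) then \<psi> s x p else 0)"
    by (simp_all add: S_def interval_sum_def)
  have d_in: "d (I, 0) \<in> carrier (free_space (S t))" if "I \<in># B" "alive t I" for I t
    using that by (auto simp: free_space_def S_def d_def)
  have z_in: "(\<lambda>_. 0) \<in> carrier (free_space (S t))" for t
    by (simp add: free_space_def)
  have dz: "d p \<noteq> (\<lambda>_. 0)" for p by (metis d_def zero_neq_one)
  \<comment> \<open>A bar born earlier would yield, at its own birth, a nonzero basis vector in a
    space with a single element.\<close>
  have start: "a \<le> fst I" if I: "I \<in># B" for I
  proof (rule ccontr)
    assume "\<not> a \<le> fst I"
    moreover have t: "0 \<le> fst I" "alive (fst I) I" using bc I by (auto simp: barcode_def alive_def)
    ultimately obtain x where "carrier (space_at M (fst I)) = {x}" using triv by force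
    hence "carrier (free_space (S (fst I))) = {\<psi> (fst I) x}"
      using bij [OF t(1)] by (simp add: bij_betw_def)
    hence "d (I, 0) = (\<lambda>_. 0)" using d_in [OF I t(2)] z_in [of "fst I"] by (metis singletonD)
    thus False using dz by blast
  qed
  \<comment> \<open>As the structure maps are identities, naturality says that passing from
    \<open>s\<close> to \<open>t\<close> just erases the coordinates of the bars dead at
    \<open>t\<close>.\<close>
  have nat': "\<psi> t x = (\<lambda>p. if alive t (fst p) then \<psi> s x p else 0)"
    if "a \<le> s" "s \<le> t" "t < b" "x \<in> V" for s t x
    using nat [of s t x] shift [of s t x] const [of s] that ab by simp
  have alive_iff: "alive s I \<longleftrightarrow> alive t I" if I: "I \<in># B" and st: "a \<le> s" "s \<le> t" "t < b" for s t I
  proof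
    have V: "0 \<le> s" "carrier (space_at M s) = V" "0 \<le> t" "carrier (space_at M t) = V"
      using const st ab by auto
    have bijs: "bij_betw (\<psi> s) V (carrier (free_space (S s)))"
      and bijt: "bij_betw (\<psi> t) V (carrier (free_space (S t)))"
      using bij [OF V(1)] bij [OF V(3)] unfolding V by blast+
    have surj: "\<exists>x\<in>V. \<psi> u x = y" if "y \<in> carrier (free_space (S u))" "u = s \<or> u = t" for u y
    proof -
      have "y \<in> \<psi> u ` V" using that bijs bijt by (metis bij_betw_imp_surj_on)
      then obtain x where "y = \<psi> u x" "x \<in> V" by (rule imageE)
      thus ?thesis by (intro bexI [of _ x]) simp_all
    qed
    {
      assume "alive t I"
      then obtain x where x: "x \<in> V" "\<psi> t x = d (I, 0)" using surj [of _ t] d_in [OF I] by metis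
      \<comment> \<open>Erasing creates no nonzero coordinate, so the one at \<open>I\<close> is
        present at \<open>s\<close> already.\<close>
      have "\<psi> s x (I, 0) \<noteq> 0"
        using nat' [OF st x(1)] \<open>alive t I\<close> x(2) by (metis d_def fst_conv zero_neq_one)
      moreover have "\<psi> s x \<in> carrier (free_space (S s))"
        using bij_betw_apply [OF bijs x(1)] .
      ultimately show "alive s I" by (auto simp: free_space_def S_def)
    next
      assume "alive s I"
      then obtain x where x: "x \<in> V" "\<psi> s x = d (I, 0)" using surj [of _ s] d_in [OF I] by metis
      \<comment> \<open>\<open>y\<close> plays the part of the zero vector in the bare set
        \<open>V\<close>. If \<open>I\<close> died before \<open>t\<close>, then \<open>x\<close>
        and \<open>y\<close> would both go to zero at \<open>t\<close>, against injectivity.\<close>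
      obtain y where y: "y \<in> V" "\<psi> s y = (\<lambda>_. 0)" using surj [of _ s] z_in by metis
      show "alive t I"
      proof (rule ccontr)
        assume "\<not> alive t I"
        hence "\<psi> t x = (\<lambda>_. 0)" using nat' [OF st x(1)] x(2) by (auto simp: d_def)
        moreover have "\<psi> t y = (\<lambda>_. 0)" using nat' [OF st y(1)] y(2) by auto
        ultimately have "x = y"
          using bij_betw_imp_inj_on [OF bijt] x(1) y(1) by (metis inj_onD)
        thus False using x y dz by metis
      qed
    }
  qed
  show *: "fst I = a \<and> ereal b \<le> snd I" if I: "I \<in># B" "fst I < b" for I
  proof
    have I': "ereal (fst I) < snd I" using bc I by (auto simp: barcode_def)
    hence "alive (fst I) I" by (simp add: alive_def)
    hence a: "alive a I" using alive_iff [OF I(1), of a "fst I"] start I by auto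
    thus "fst I = a" using start [OF I(1)] by (simp add: alive_def)
    show "ereal b \<le> snd I"
    proof (rule ccontr)
      assume "\<not> ereal b \<le> snd I"
      \<comment> \<open>At its right endpoint \<open>e\<close> the bar is dead, although the set of
        alive bars does not change between \<open>a\<close> and \<open>e\<close>.\<close>
      then obtain e where e: "snd I = ereal e" "e < b" using I' by (cases "snd I") auto
      hence "alive e I" using alive_iff [OF I(1), of a e] a by (auto simp: alive_def)
      thus False using e by (simp add: alive_def)
    qed
  qed
  have "alive a I \<longleftrightarrow> fst I < b" if "I \<in># B" for I
  proof
    assume "fst I < b"
    hence "fst I = a" "ereal b \<le> snd I" using * that by auto
    thus "alive a I" using ab less_le_trans [of "ereal a" "ereal b"] by (simp add: alive_def)
  qed (use ab in \<open>simp add: alive_def\<close>)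
  moreover have "I \<in># B" if "i < count B I" for i I
    using that by (metis count_inI not_less_zero)
  ultimately have "S a = (SIGMA I:{I \<in> set_mset B. fst I < b}. {..<count B I})"
    unfolding S_def by auto
  hence "finite (S a)" "card (S a) = (\<Sum>I | I \<in># B \<and> fst I < b. count B I)"
    by (simp_all add: card_SigmaI)
  moreover have "size {#I \<in># B. fst I < b#} = (\<Sum>I | I \<in># B \<and> fst I < b. count B I)"
    by (simp add: size_multiset_overloaded_eq)
  moreover have "card V = card (carrier (free_space (S a)))"
    using bij_betw_same_card [OF bij [OF ab(1)]] const [of a] ab(2) by simp
  ultimately show "card V = 2 ^ size {#I \<in># B. fst I < b#}" by (simp add: card_free_space)
qed

section \<open>Counting long bars in an approximate barcode\<close>

lemma rel_mset_size_filter: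
  assumes "rel_mset R A B" "\<And>x y. x \<in># A \<Longrightarrow> y \<in># B \<Longrightarrow> R x y \<Longrightarrow> P x \<longleftrightarrow> Q y"
  shows "size (filter_mset P A) = size (filter_mset Q B)"
proof -
  obtain xs ys where l: "list_all2 R xs ys" and *: "A = mset xs" "B = mset ys"
    using assms(1) by (auto simp: rel_mset_def)
  have "\<forall>x\<in>set xs. \<forall>y\<in>set ys. R x y \<longrightarrow> P x = Q y" using assms(2) * by simp
  with l have "length (filter P xs) = length (filter Q ys)" by induction auto
  thus ?thesis using * by (simp flip: mset_filter)
qed

text \<open>For a tolerance below \<open>h\<close>, partners of bars born at \<open>a\<close> pass
  the two thresholds, while partners of bars born at \<open>b\<close> or later are born after
  \<open>b - h\<close> and fail. Unmatched bars are shorter than \<open>2 * h\<close>, whereas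
  passing the thresholds requires a length above \<open>b - a - 2 * h\<close>; this is where
  \<open>4 * h\<close> comes from.\<close>

lemma size_filter_bottleneck:
  assumes dist: "bottleneck_dist C B \<le> ereal \<epsilon>" and eps: "\<epsilon> < h" "4 * h \<le> b - a"
    and B: "\<And>I. I \<in># B \<Longrightarrow> fst I < b \<Longrightarrow> fst I = a \<and> ereal b \<le> snd I"
  shows "size {#I \<in># C. fst I < a + h \<and> ereal (b - h) < snd I#} =
    size {#I \<in># B. fst I < b#}"
proof -
  \<comment> \<open>The distance is an infimum, so a matching is guaranteed only for tolerances
    slightly above it; \<open>\<epsilon> < h\<close> leaves the room.\<close>
  have "bottleneck_dist C B < ereal h" using dist eps(1) by (metis less_ereal.simps(1) order_le_less_trans)
  then obtain \<delta> where \<delta>: "0 \<le> \<delta>" "matching \<delta> C B" "\<delta> < h"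
    unfolding bottleneck_dist_def INF_less_iff by auto
  then obtain C1 C2 B1 B2 where *: "C = C1 + C2" "B = B1 + B2" "rel_mset (bars_close \<delta>) C1 B1"
    and short: "\<And>I. I \<in># C2 + B2 \<Longrightarrow> snd I \<le> ereal (fst I) + ereal (2 * \<delta>)"
    unfolding matching_def by blast
  let ?P = "\<lambda>I. fst I < a + h \<and> ereal (b - h) < snd I" and ?Q = "\<lambda>I. fst I < b"
  have "size (filter_mset ?P C1) = size (filter_mset ?Q B1)"
  proof (rule rel_mset_size_filter [OF *(3)])
    fix I J assume J: "J \<in># B1" and close: "bars_close \<delta> I J"
    show "?P I \<longleftrightarrow> ?Q J"
    proof
      assume "?P I"
      thus "?Q J" using close \<delta> eps(2) by (auto simp: bars_close_def)
    next
      assume "?Q J"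
      hence J': "fst J = a" "ereal b \<le> snd J" using B J * by auto
      have "ereal b \<le> snd I + ereal \<delta>" using J'(2) close by (auto simp: bars_close_def intro: order_trans)
      hence "ereal (b - h) < snd I" using \<delta> by (cases "snd I") auto
      thus "?P I" using J' close \<delta> eps(2) by (auto simp: bars_close_def)
    qed
  qed
  moreover have "filter_mset ?P C2 = {#}"
  proof -
    have "\<not> ?P I" if "I \<in># C2" for I
      using short [of I] that \<delta>(3) eps(2) by (cases "snd I") auto
    thus ?thesis by (simp only: filter_mset_eq_mempty_iff) blast
  qed
  moreover have "filter_mset ?Q B2 = {#}"
  proof -
    have "\<not> ?Q I" if "I \<in># B2" for I
      using short [of I] that \<delta> eps(2) B [of I] * by (cases "snd I") auto
    thus ?thesis by (simp only: filter_mset_eq_mempty_iff) blast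
  qed
  ultimately show ?thesis unfolding * by (simp only: filter_union_mset size_union size_empty)
qed

section \<open>The graph of a sparse matrix\<close>

text \<open>Each entry owns seven consecutive numbers, and the offset is the type of the point.
  \<open>pole False\<close> (north) and \<open>pole True\<close> (south) are the common ends of both
  arcs of a row circle. The flag of \<open>mid\<close> selects the arc, and that of
  \<open>apex\<close> the disc running through this arc.\<close>

definition pole :: "bool \<Rightarrow> nat \<Rightarrow> nat" where "pole o' e = 7 * e + of_bool o'"
definition mid :: "bool \<Rightarrow> nat \<Rightarrow> nat" where "mid h e = 7 * e + 2 + of_bool h"
definition seam :: "nat \<Rightarrow> nat" where "seam e = 7 * e + 4"
definition apex :: "bool \<Rightarrow> nat \<Rightarrow> nat" where "apex h e = 7 * e + 5 + of_bool h"

lemmas point_defs = pole_def mid_def seam_def apex_def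

lemma point_eq_iff [simp]:
  "pole a e = pole a' e' \<longleftrightarrow> a = a' \<and> e = e'"
  "mid a e = mid a' e' \<longleftrightarrow> a = a' \<and> e = e'"
  "seam e = seam e' \<longleftrightarrow> e = e'"
  "apex a e = apex a' e' \<longleftrightarrow> a = a' \<and> e = e'"
  by (cases a; cases a'; simp add: point_defs; presburger)+

lemma point_neq [simp]:
  "pole a e \<noteq> mid a' e'" "mid a' e' \<noteq> pole a e"
  "pole a e \<noteq> seam e'" "seam e' \<noteq> pole a e"
  "pole a e \<noteq> apex a' e'" "apex a' e' \<noteq> pole a e"
  "mid a e \<noteq> seam e'" "seam e' \<noteq> mid a e"
  "mid a e \<noteq> apex a' e'" "apex a' e' \<noteq> mid a e"
  "seam e \<noteq> apex a' e'" "apex a' e' \<noteq> seam e"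
  by (cases a; cases a'; simp add: point_defs; presburger)+

lemma point_less:
  assumes "e < m"
  shows "pole a e < 7 * m" "mid a e < 7 * m" "seam e < 7 * m" "apex a e < 7 * m"
  using assms by (cases a; simp add: point_defs)+

text \<open>The seam of \<open>e\<close> joins the north pole of its row to the south pole of the
  row of \<open>pv e\<close>. So \<open>apex h\<close> is coned over the cycle north pole, arc
  \<open>h\<close>, south pole, seam of the next entry, north pole of that entry, and so on. Every
  pair goes from a higher to a lower type (apex, then midpoint or seam, then pole), hence no edge is
  listed in both orientations.\<close>

definition edge_list :: "(nat \<Rightarrow> nat) \<Rightarrow> (nat \<Rightarrow> nat) \<Rightarrow> (nat \<Rightarrow> nat) \<Rightarrow> nat \<Rightarrow> (nat \<times> nat) list" where
  "edge_list r c pv e =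
    [(seam e, pole False (r e)), (seam e, pole True (r (pv e))),
     (mid False (r e), pole False (r e)), (mid False (r e), pole True (r e)),
     (mid True (r e), pole False (r e)), (mid True (r e), pole True (r e)),
     (apex False (c e), pole False (r e)), (apex False (c e), pole True (r e)),
     (apex True (c e), pole False (r e)), (apex True (c e), pole True (r e)),
     (apex False (c e), mid False (r e)), (apex True (c e), mid True (r e)),
     (apex False (c e), seam e), (apex True (c e), seam e)]"

definition edges :: "nat \<Rightarrow> (nat \<Rightarrow> nat) \<Rightarrow> (nat \<Rightarrow> nat) \<Rightarrow> (nat \<Rightarrow> nat) \<Rightarrow> (nat \<times> nat) set" where
  "edges m r c pv = (\<Union>e<m. set (edge_list r c pv e))"

text \<open>
  \<open>r e\<close> and \<open>c e\<close> are the entries that represent the row and the column of the entry \<open>e\<close>, and \<open>pv\<close>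
  permutes the entries of each column cyclically.
\<close>

locale incidence =
  fixes m :: nat and r c pv :: "nat \<Rightarrow> nat"
  assumes r_less: "e < m \<Longrightarrow> r e < m"
    and c_less: "e < m \<Longrightarrow> c e < m"
    and c_c: "e < m \<Longrightarrow> c (c e) = c e"
    and pv_less: "e < m \<Longrightarrow> pv e < m"
    and c_pv: "e < m \<Longrightarrow> c (pv e) = c e"
    and pv_inj: "e < m \<Longrightarrow> e' < m \<Longrightarrow> pv e = pv e' \<Longrightarrow> e = e'"
    and r_c_inj: "e < m \<Longrightarrow> e' < m \<Longrightarrow> r e = r e' \<Longrightarrow> c e = c e' \<Longrightarrow> e = e'"
    and pv_connected: "\<And>\<beta> :: nat \<Rightarrow> bit. (\<And>e. e < m \<Longrightarrow> \<beta> (pv e) = \<beta> e) \<Longrightarrow> e < m \<Longrightarrow> \<beta> e = \<beta> (c e)"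
begin

definition adj :: "nat \<Rightarrow> nat \<Rightarrow> bool" where
  "adj u v \<longleftrightarrow> (u, v) \<in> edges m r c pv \<or> (v, u) \<in> edges m r c pv"

definition dist :: "nat \<Rightarrow> nat \<Rightarrow> real" where
  "dist u v = (if u = v then 0 else if adj u v then 1 / 2 else 1)"

lemma adj_commute: "adj u v \<longleftrightarrow> adj v u"
  by (auto simp: adj_def)

lemma adj_iff: "adj u v \<longleftrightarrow> (\<exists>e<m. (u, v) \<in> set (edge_list r c pv e) \<or> (v, u) \<in> set (edge_list r c pv e))"
  unfolding adj_def edges_def by blast

lemma adj_pole: "adj x (pole a i) \<longleftrightarrow>
    (\<exists>e<m. x = seam e \<and> i = (if a then r (pv e) else r e) \<or>
      i = r e \<and> (\<exists>h. x = mid h (r e) \<or> x = apex h (c e)))"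
  unfolding adj_iff
  by (rule ex_cong1, rule conj_cong [OF refl], cases a; simp add: edge_list_def ex_bool_eq; argo)

lemma adj_mid: "adj x (mid h i) \<longleftrightarrow> (\<exists>e<m. i = r e \<and> (x = apex h (c e) \<or> (\<exists>a. x = pole a (r e))))"
  unfolding adj_iff
  by (rule ex_cong1, rule conj_cong [OF refl], cases h; simp add: edge_list_def ex_bool_eq; argo)

lemma adj_seam: "adj x (seam e) \<longleftrightarrow> e < m \<and>
    (x = pole False (r e) \<or> x = pole True (r (pv e)) \<or> (\<exists>h. x = apex h (c e)))"
proof -
  have "(x, seam e) \<in> set (edge_list r c pv k) \<or> (seam e, x) \<in> set (edge_list r c pv k) \<longleftrightarrow>
    k = e \<and> (x = pole False (r e) \<or> x = pole True (r (pv e)) \<or> (\<exists>h. x = apex h (c e)))" for k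
    by (cases "k = e"; simp add: edge_list_def ex_bool_eq; argo?)
  thus ?thesis by (simp add: adj_iff)
qed

lemma adj_apex: "adj x (apex h k) \<longleftrightarrow>
    (\<exists>e<m. k = c e \<and> (x = seam e \<or> x = mid h (r e) \<or> (\<exists>a. x = pole a (r e))))"
proof -
  have "(x, apex h k) \<in> set (edge_list r c pv e) \<or> (apex h k, x) \<in> set (edge_list r c pv e) \<longleftrightarrow>
    k = c e \<and> (x = seam e \<or> x = mid h (r e) \<or> (\<exists>a. x = pole a (r e)))" for e
    by (cases h; cases "k = c e"; simp add: edge_list_def ex_bool_eq disj_ac)
  thus ?thesis by (simp add: adj_iff)
qed

text \<open>A proper colouring of the graph with three colours: poles, then midpoints and seams,
  then apexes. It bounds the size of cliques.\<close>

definition level :: "nat \<Rightarrow> nat" where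
  "level v = (if v mod 7 < 2 then 0 else if v mod 7 < 5 then 1 else 2)"

lemma level_simps [simp]:
  "level (pole a e) = 0" "level (mid a e) = 1" "level (seam e) = 1" "level (apex a e) = 2"
proof -
  have "(7 * e + k) mod 7 = k" if "k < 7" for k :: nat
    using that by (simp add: mod_mult_self4)
  from this [of 0] this [of 1] this [of 2] this [of 3] this [of 4] this [of 5] this [of 6]
  show "level (pole a e) = 0" "level (mid a e) = 1" "level (seam e) = 1" "level (apex a e) = 2"
    by (cases a; simp add: point_defs level_def)+
qed

lemma adj_less:
  assumes "adj u v"
  shows "u < 7 * m" "v < 7 * m"
  using assms r_less c_less pv_less
  by (auto simp: adj_def edges_def edge_list_def intro!: point_less)

lemma adj_level:
  assumes "adj u v"
  shows "level u \<noteq> level v"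
  using assms by (auto simp: adj_def edges_def edge_list_def)

lemma not_adj_self [simp]: "\<not> adj u u"
  using adj_level by blast

text \<open>The triangle inequality is automatic when all nonzero distances lie between 1/2 and
  1.\<close>

lemma Metric_space_dist: "Metric_space {..<7 * m} dist"
  by unfold_locales (auto simp: dist_def adj_commute)

lemma diam_le_dist: "diam_le dist {..<7 * m} 1"
  by (auto simp: diam_le_def dist_def)

section \<open>The clique complex of the graph\<close>

abbreviation K where "K \<equiv> vietoris_rips {..<7 * m} dist (1 / 4)"

lemma K_eq: "K = {\<sigma>. \<sigma> \<subseteq> {..<7 * m} \<and> finite \<sigma> \<and> \<sigma> \<noteq> {} \<and> (\<forall>x\<in>\<sigma>. \<forall>y\<in>\<sigma>. x \<noteq> y \<longrightarrow> adj x y)}"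
proof -
  have "dist x y \<le> 1 / 2 \<longleftrightarrow> (x \<noteq> y \<longrightarrow> adj x y)" for x y by (auto simp: dist_def)
  thus ?thesis by (auto simp: vietoris_rips_def diam_le_def)
qed

text \<open>No distance lies strictly between 1/2 and 1.\<close>

lemma vietoris_rips_eq_K:
  assumes "1 / 4 \<le> t" "t < 1 / 2"
  shows "vietoris_rips {..<7 * m} dist t = K"
proof -
  have "dist x y \<le> 2 * t \<longleftrightarrow> dist x y \<le> 1 / 2" for x y using assms by (auto simp: dist_def)
  thus ?thesis by (auto simp: vietoris_rips_def diam_le_def)
qed

lemma vietoris_rips_discrete:
  assumes "0 \<le> t" "t < 1 / 4" "k > 0"
  shows "simplices (vietoris_rips {..<7 * m} dist t) k = {}"
proof -
  have "dist x y \<le> 2 * t \<longleftrightarrow> x = y" for x y using assms by (auto simp: dist_def)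
  hence "card \<sigma> \<le> 1" if "\<sigma> \<in> vietoris_rips {..<7 * m} dist t" for \<sigma>
    using that by (intro card_le_Suc0_iff_eq [THEN iffD2, unfolded One_nat_def [symmetric]])
      (auto simp: vietoris_rips_def diam_le_def)
  thus ?thesis using assms(3) by (fastforce simp: simplices_def)
qed

text \<open>\<open>level\<close> is injective on cliques and takes three values.\<close>

lemma simplices_K_3: "simplices K 3 = {}"
proof -
  have "card \<sigma> \<le> 3" if "\<sigma> \<in> K" for \<sigma>
  proof -
    have "inj_on level \<sigma>" using that adj_level by (auto simp: K_eq inj_on_def)
    moreover have "level ` \<sigma> \<subseteq> {0, 1, 2}" by (auto simp: level_def)
    ultimately have "card \<sigma> \<le> card {0, 1, 2 :: nat}" by (intro card_inj_on_le) auto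
    thus ?thesis by simp
  qed
  thus ?thesis by (force simp: simplices_def)
qed

lemma boundary_eq:
  assumes z: "z \<in> carrier (chains K 2)" and "\<tau> \<noteq> {}"
  shows "boundary z \<tau> = (\<Sum>x | x \<notin> \<tau> \<and> insert x \<tau> \<in> simplices K 2. z (insert x \<tau>))"
proof -
  have supp: "z \<sigma> \<noteq> 0 \<Longrightarrow> \<sigma> \<in> simplices K 2" for \<sigma>
    using z by (auto simp: chains_def free_space_def)
  have "boundary z \<tau> = (\<Sum>x | x \<notin> \<tau> \<and> z (insert x \<tau>) \<noteq> 0. z (insert x \<tau>))"
    unfolding boundary_def if_not_P [OF assms(2)]
  proof (rule sum.reindex_cong [where l = "\<lambda>x. insert x \<tau>"])
    show "inj_on (\<lambda>x. insert x \<tau>) {x. x \<notin> \<tau> \<and> z (insert x \<tau>) \<noteq> 0}"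
      by (auto simp: inj_on_def)
  qed auto
  also have "\<dots> = (\<Sum>x | x \<notin> \<tau> \<and> insert x \<tau> \<in> simplices K 2. z (insert x \<tau>))"
  proof (rule sum.mono_neutral_left)
    show "finite {x. x \<notin> \<tau> \<and> insert x \<tau> \<in> simplices K 2}"
      by (rule finite_subset [of _ "{..<7 * m}"]) (auto simp: simplices_def K_eq)
  qed (use supp in auto)
  finally show ?thesis .
qed

text \<open>In a clique complex the triangles over an edge correspond to the common neighbours of
  its ends.\<close>

lemma boundary_edge:
  assumes z: "z \<in> carrier (chains K 2)" and uv: "adj u v"
  shows "boundary z {u, v} = (\<Sum>x | adj x u \<and> adj x v. z {x, u, v})"
proof -
  have "u \<noteq> v" using uv by auto
  have "x \<notin> {u, v} \<and> insert x {u, v} \<in> simplices K 2 \<longleftrightarrow> adj x u \<and> adj x v" for x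
  proof
    assume *: "adj x u \<and> adj x v"
    hence "x \<noteq> u" "x \<noteq> v" "x < 7 * m" "u < 7 * m" "v < 7 * m"
      using adj_less(1) [of x u] adj_less [OF uv] by auto
    thus "x \<notin> {u, v} \<and> insert x {u, v} \<in> simplices K 2"
      using * uv \<open>u \<noteq> v\<close> adj_commute by (simp add: simplices_def K_eq)
  qed (auto simp: simplices_def K_eq)
  thus ?thesis by (simp add: boundary_eq [OF z])
qed

text \<open>A triangle has one vertex of each level. The edge between apex and middle vertex fixes
  an entry \<open>e\<close>, and then only two poles are left for the lowest vertex.\<close>

lemma triangle_cases:
  assumes "\<sigma> \<in> simplices K 2"
  obtains h a e where "e < m" "\<sigma> = {apex h (c e), mid h (r e), pole a (r e)}"
  | h e where "e < m" "\<sigma> = {apex h (c e), seam e, pole False (r e)}"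
  | h e where "e < m" "\<sigma> = {apex h (c e), seam e, pole True (r (pv e))}"
proof -
  have \<sigma>: "card \<sigma> = 3" "\<forall>x\<in>\<sigma>. \<forall>y\<in>\<sigma>. x \<noteq> y \<longrightarrow> adj x y"
    using assms by (auto simp: simplices_def K_eq)
  hence inj: "inj_on level \<sigma>" using adj_level by (auto simp: inj_on_def)
  have "level ` \<sigma> = {0, 1, 2}"
  proof (rule card_subset_eq)
    show "card (level ` \<sigma>) = card {0, 1, 2 :: nat}" using \<sigma>(1) by (simp add: card_image [OF inj])
  qed (auto simp: level_def)
  hence "2 \<in> level ` \<sigma>" "1 \<in> level ` \<sigma>" "0 \<in> level ` \<sigma>" by auto
  then obtain p u v where puv: "p \<in> \<sigma>" "level p = 2" "u \<in> \<sigma>" "level u = 1" "v \<in> \<sigma>" "level v = 0"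
    by (elim imageE) (metis that)
  have neq: "p \<noteq> u" "p \<noteq> v" "u \<noteq> v" using puv by auto
  have "{p, u, v} = \<sigma>"
    using \<sigma>(1) puv neq by (intro card_subset_eq) (auto intro: card_ge_0_finite)
  moreover have "adj u p" "adj v p" "adj v u" using \<sigma>(2) puv neq by auto
  moreover obtain h k where p: "p = apex h k"
    using \<open>adj u p\<close> puv by (auto simp: adj_def edges_def edge_list_def)
  ultimately obtain e where e: "e < m" "k = c e" "u = seam e \<or> u = mid h (r e)"
    using puv(4) by (auto simp: adj_apex)
  from e(3) show ?thesis
  proof
    assume u: "u = seam e"
    hence "v = pole False (r e) \<or> v = pole True (r (pv e))"
      using \<open>adj v u\<close> puv(6) by (auto simp: adj_seam)
    thus ?thesis
    proof
      assume "v = pole False (r e)"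
      thus ?thesis using that(2) [OF e(1), of h] u p e(2) \<open>{p, u, v} = \<sigma>\<close> by simp
    next
      assume "v = pole True (r (pv e))"
      thus ?thesis using that(3) [OF e(1), of h] u p e(2) \<open>{p, u, v} = \<sigma>\<close> by simp
    qed
  next
    assume u: "u = mid h (r e)"
    then obtain a where "v = pole a (r e)"
      using \<open>adj v u\<close> puv(6) by (auto simp: adj_mid)
    thus ?thesis using that(1) [OF e(1), of h a] u p e(2) \<open>{p, u, v} = \<sigma>\<close> by simp
  qed
qed

text \<open>The sum of the spheres of the columns selected by \<open>u\<close>. A triangle has a
  single apex, and division by 7 recovers the representative of its column, so the sum has one
  summand.\<close>

definition chain_of :: "(nat \<Rightarrow> bit) \<Rightarrow> nat set \<Rightarrow> bit" where
  "chain_of u \<sigma> = (if \<sigma> \<in> simplices K 2 then \<Sum>p | p \<in> \<sigma> \<and> level p = 2. u (p div 7) else 0)"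

lemma adj_seam_apex_iff: "adj (seam e) (apex h k) \<longleftrightarrow> e < m \<and> k = c e"
  by (auto simp: adj_apex)

lemma adj_mid_apex_iff: "adj (mid h' i) (apex h k) \<longleftrightarrow> h' = h \<and> (\<exists>e<m. i = r e \<and> k = c e)"
  by (auto simp: adj_apex)

lemma adj_pole_apex_iff: "adj (pole a i) (apex h k) \<longleftrightarrow> (\<exists>e<m. i = r e \<and> k = c e)"
  by (auto simp: adj_apex)

lemma adj_pole_mid_iff: "adj (pole a i) (mid h i') \<longleftrightarrow> i = i' \<and> (\<exists>e<m. i = r e)"
  by (auto simp: adj_mid)

lemma
  assumes e: "e < m"
  shows adj_mid_apex: "adj (mid h (r e)) (apex h (c e))"
    and adj_seam_apex: "adj (seam e) (apex h (c e))"
    and adj_pole_apex: "adj (pole a (r e)) (apex h (c e))"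
    and adj_pole_pv_apex: "adj (pole a (r (pv e))) (apex h (c e))"
    and adj_pole_mid: "adj (pole a (r e)) (mid h (r e))"
    and adj_north_seam: "adj (pole False (r e)) (seam e)"
    and adj_south_seam: "adj (pole True (r (pv e))) (seam e)"
proof -
  show "adj (pole a (r (pv e))) (apex h (c e))"
    unfolding adj_pole_apex_iff using pv_less [OF e] c_pv [OF e, symmetric] by blast
qed (use e in \<open>auto simp: adj_mid_apex_iff adj_seam_apex_iff adj_pole_apex_iff adj_pole_mid_iff adj_seam\<close>)

lemma triangleI:
  assumes "adj u v" "adj x u" "adj x v"
  shows "{u, v, x} \<in> simplices K 2"
proof -
  have "u \<noteq> v" "x \<noteq> u" "x \<noteq> v" "x < 7 * m" "u < 7 * m" "v < 7 * m"
    using adj_less(1) [of x u] adj_less [of u v] assms by auto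
  thus ?thesis using assms adj_commute by (simp add: simplices_def K_eq)
qed

lemma triangles:
  assumes "e < m"
  shows "{apex h (c e), mid h (r e), pole a (r e)} \<in> simplices K 2"
    "{apex h (c e), seam e, pole False (r e)} \<in> simplices K 2"
    "{apex h (c e), seam e, pole True (r (pv e))} \<in> simplices K 2"
  by (intro triangleI adj_pole_mid adj_north_seam adj_south_seam adj_pole_apex adj_pole_pv_apex
      adj_mid_apex [THEN adj_commute [THEN iffD1]] adj_seam_apex [THEN adj_commute [THEN iffD1]] assms)+

lemma chain_of_triangle:
  assumes "e < m"
  shows "chain_of u {apex h (c e), mid h (r e), pole a (r e)} = u (c e)"
    "chain_of u {apex h (c e), seam e, pole False (r e)} = u (c e)"
    "chain_of u {apex h (c e), seam e, pole True (r (pv e))} = u (c e)"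
proof -
  have "{p. (p = x \<or> p = y \<or> p = z) \<and> level p = 2} = {x}"
    if "level x = 2" "level y \<noteq> 2" "level z \<noteq> 2" for x y z using that by auto
  moreover have "apex h (c e) div 7 = c e" by (cases h) (simp_all add: apex_def)
  ultimately show "chain_of u {apex h (c e), mid h (r e), pole a (r e)} = u (c e)"
    "chain_of u {apex h (c e), seam e, pole False (r e)} = u (c e)"
    "chain_of u {apex h (c e), seam e, pole True (r (pv e))} = u (c e)"
    using triangles [OF assms] by (simp_all add: chain_of_def)
qed

lemma chain_of_in_chains: "chain_of u \<in> carrier (chains K 2)"
proof -
  have "finite (simplices K 2)"
    by (rule finite_subset [of _ "Pow {..<7 * m}"]) (auto simp: simplices_def K_eq)
  thus ?thesis
    by (auto simp: chains_def free_space_def chain_of_def split: if_splits intro: finite_subset)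
qed

text \<open>As in a surface, an edge containing an apex or a seam lies in two triangles. An edge of
  a row circle lies in one triangle for each entry of the row. That an apex and a pole of a given
  kind share only one seam rests on entries being determined by their row and column.\<close>

lemma
  assumes e: "e < m"
  shows link_apex_seam: "{x. adj x (apex h (c e)) \<and> adj x (seam e)} = {pole False (r e), pole True (r (pv e))}"
    and link_apex_mid: "{x. adj x (apex h (c e)) \<and> adj x (mid h (r e))} = {pole False (r e), pole True (r e)}"
    and link_apex_north: "{x. adj x (apex h (c e)) \<and> adj x (pole False (r e))} = {mid h (r e), seam e}"
    and link_apex_south: "{x. adj x (apex h (c e)) \<and> adj x (pole True (r (pv e)))} = {mid h (r (pv e)), seam e}"
    and link_seam_north: "{x. adj x (seam e) \<and> adj x (pole False (r e))} = {apex False (c e), apex True (c e)}"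
    and link_seam_south: "{x. adj x (seam e) \<and> adj x (pole True (r (pv e)))} = {apex False (c e), apex True (c e)}"
    and link_mid_pole: "{x. adj x (mid h (r e)) \<and> adj x (pole a (r e))} =
      (\<lambda>e'. apex h (c e')) ` {e'. e' < m \<and> r e' = r e}"
proof -
  have pv: "adj (mid h (r (pv e))) (apex h (c e))" "adj (pole True (r (pv e))) (mid h (r (pv e)))"
    using adj_mid_apex [OF pv_less [OF e]] adj_pole_mid [OF pv_less [OF e]] by (simp_all add: c_pv [OF e])
  note adjs = pv adj_mid_apex [OF e] adj_seam_apex [OF e] adj_pole_apex [OF e] adj_pole_pv_apex [OF e]
    adj_pole_mid [OF e] adj_north_seam [OF e] adj_south_seam [OF e]
  note adjs' = adjs [THEN adj_commute [THEN iffD1]]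
  show "{x. adj x (apex h (c e)) \<and> adj x (seam e)} = {pole False (r e), pole True (r (pv e))}"
  proof
    show "{x. adj x (apex h (c e)) \<and> adj x (seam e)} \<subseteq> {pole False (r e), pole True (r (pv e))}"
      by (auto simp: adj_seam dest: adj_level)
  qed (auto intro: adjs)
  show "{x. adj x (apex h (c e)) \<and> adj x (mid h (r e))} = {pole False (r e), pole True (r e)}"
  proof
    show "{x. adj x (apex h (c e)) \<and> adj x (mid h (r e))} \<subseteq> {pole False (r e), pole True (r e)}"
      by (auto simp: adj_mid dest: adj_level)
  qed (auto intro: adjs)
  show "{x. adj x (apex h (c e)) \<and> adj x (pole False (r e))} = {mid h (r e), seam e}"
  proof
    show "{x. adj x (apex h (c e)) \<and> adj x (pole False (r e))} \<subseteq> {mid h (r e), seam e}"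
      using r_c_inj [OF e] by (auto simp: adj_pole adj_seam_apex_iff adj_mid_apex_iff dest: adj_level)
  qed (auto intro: adjs adjs')
  show "{x. adj x (apex h (c e)) \<and> adj x (pole True (r (pv e)))} = {mid h (r (pv e)), seam e}"
  proof
    \<comment> \<open>In one column, equal rows of the predecessors force equal predecessors, and
      \<open>pv\<close> is injective.\<close>
    have "e' = e" if "e' < m" "c e = c e'" "r (pv e) = r (pv e')" for e'
      using that e pv_inj r_c_inj [of "pv e" "pv e'"] pv_less c_pv by metis
    thus "{x. adj x (apex h (c e)) \<and> adj x (pole True (r (pv e)))} \<subseteq> {mid h (r (pv e)), seam e}"
      by (auto simp: adj_pole adj_seam_apex_iff adj_mid_apex_iff dest: adj_level)
  qed (auto intro: adjs adjs')
  show "{x. adj x (seam e) \<and> adj x (pole False (r e))} = {apex False (c e), apex True (c e)}"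
  proof
    show "{x. adj x (seam e) \<and> adj x (pole False (r e))} \<subseteq> {apex False (c e), apex True (c e)}"
      by (auto simp: adj_seam dest: adj_level)
  qed (auto intro: adjs adjs')
  show "{x. adj x (seam e) \<and> adj x (pole True (r (pv e)))} = {apex False (c e), apex True (c e)}"
  proof
    show "{x. adj x (seam e) \<and> adj x (pole True (r (pv e)))} \<subseteq> {apex False (c e), apex True (c e)}"
      by (auto simp: adj_seam dest: adj_level)
  qed (auto intro: adjs adjs')
  show "{x. adj x (mid h (r e)) \<and> adj x (pole a (r e))} =
      (\<lambda>e'. apex h (c e')) ` {e'. e' < m \<and> r e' = r e}"
  proof
    show "{x. adj x (mid h (r e)) \<and> adj x (pole a (r e))} \<subseteq>
        (\<lambda>e'. apex h (c e')) ` {e'. e' < m \<and> r e' = r e}"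
      by (auto simp: adj_mid dest: adj_level)
    show "(\<lambda>e'. apex h (c e')) ` {e'. e' < m \<and> r e' = r e} \<subseteq>
        {x. adj x (mid h (r e)) \<and> adj x (pole a (r e))}"
      using adj_commute adj_mid_apex adj_pole_apex by (auto; metis)
  qed
qed

section \<open>The 2-cycles and the null vectors\<close>

lemma boundary_link_pair:
  assumes "z \<in> carrier (chains K 2)" "adj u v" "{x. adj x u \<and> adj x v} = {x, y}" "x \<noteq> y"
  shows "boundary z {u, v} = z {u, v, x} + z {u, v, y}"
proof -
  have "boundary z {u, v} = (\<Sum>w\<in>{x, y}. z {w, u, v})"
    by (simp add: boundary_edge [OF assms(1,2)] assms(3))
  thus ?thesis using assms(4) by (simp add: insert_commute)
qed

text \<open>This is how the matrix enters: on a row circle the boundary coefficient is a sum over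
  the entries of the row.\<close>

lemma boundary_mid_pole:
  assumes z: "z \<in> carrier (chains K 2)" and e: "e < m"
  shows "boundary z {mid h (r e), pole a (r e)} =
    (\<Sum>e' | e' < m \<and> r e' = r e. z {apex h (c e'), mid h (r e'), pole a (r e')})"
proof -
  have "inj_on (\<lambda>e'. apex h (c e')) {e'. e' < m \<and> r e' = r e}"
    using r_c_inj by (auto simp: inj_on_def)
  moreover have "adj (mid h (r e)) (pole a (r e))"
    using adj_pole_mid [OF e] adj_commute by blast
  ultimately show ?thesis
    by (simp add: boundary_edge [OF z] link_mid_pole [OF e] sum.reindex)
qed

text \<open>Over an edge with two triangles, both carry the coefficient of the same column and
  cancel. On the row circles the coefficient is a row sum, which vanishes for null vectors.\<close>

lemma boundary_chain_of:
  assumes u: "u \<in> null_vectors m r c"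
  shows "boundary (chain_of u) \<tau> = 0"
proof (cases "\<tau> \<noteq> {} \<and> (\<exists>x. x \<notin> \<tau> \<and> insert x \<tau> \<in> simplices K 2)")
  case False
  show ?thesis
  proof (cases "\<tau> = {}")
    case \<tau>: False
    with False have "{x. x \<notin> \<tau> \<and> insert x \<tau> \<in> simplices K 2} = {}" by blast
    thus ?thesis unfolding boundary_eq [OF chain_of_in_chains \<tau>] by (simp only: sum.empty)
  qed (simp add: boundary_def)
next
  case True
  then obtain x where x: "x \<notin> \<tau>" "insert x \<tau> \<in> simplices K 2" by blast
  hence "card \<tau> = 2" by (auto simp: simplices_def)
  then obtain v w where vw: "\<tau> = {v, w}" "v \<noteq> w" by (auto simp: card_2_iff)
  hence "adj v w" using x(2) by (auto simp: simplices_def K_eq)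
  note pair = boundary_link_pair [OF chain_of_in_chains]
  have "boundary (chain_of u) {v, w} = 0" if vw: "(v, w) \<in> edges m r c pv" for v w
  proof -
    from vw obtain e where e: "e < m" "(v, w) \<in> set (edge_list r c pv e)"
      by (auto simp: edges_def)
    have "pv ` {..<m} = {..<m}"
      using pv_less pv_inj by (intro endo_inj_surj) (auto simp: inj_on_def)
    \<comment> \<open>The edge from an apex to the south pole of \<open>r e\<close> belongs to the
      seam of the entry \<open>e'\<close> after \<open>e\<close>, which exists because an injective
      self-map of a finite set is onto.\<close>
    then obtain e' where e': "e' < m" "pv e' = e" using e(1) by (metis imageE lessThan_iff)
    have mp: "boundary (chain_of u) {mid h (r e), pole a (r e)} = 0" for h a
    proof -
      have "boundary (chain_of u) {mid h (r e), pole a (r e)} = (\<Sum>e' | e' < m \<and> r e' = r e. u (c e'))"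
        unfolding boundary_mid_pole [OF chain_of_in_chains e(1)]
        using chain_of_triangle(1) by (intro sum.cong refl) blast
      thus ?thesis using u e(1) by (simp add: null_vectors_def)
    qed
    have as: "boundary (chain_of u) {apex h (c e), seam e} = 0" for h
      by (subst pair [OF _ link_apex_seam [OF e(1)]])
        (use e in \<open>simp_all add: adj_commute [of "apex _ _"] adj_seam_apex chain_of_triangle\<close>)
    have am: "boundary (chain_of u) {apex h (c e), mid h (r e)} = 0" for h
      by (subst pair [OF _ link_apex_mid [OF e(1)]])
        (use e in \<open>simp_all add: adj_commute [of "apex _ _"] adj_mid_apex chain_of_triangle\<close>)
    have an: "boundary (chain_of u) {apex h (c e), pole False (r e)} = 0" for h
      by (subst pair [OF _ link_apex_north [OF e(1)]])
        (use e in \<open>simp_all add: adj_commute [of "apex _ _"] adj_pole_apex chain_of_triangle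
          insert_commute [of "pole _ _"]\<close>)
    have as': "boundary (chain_of u) {apex h (c e), pole True (r e)} = 0" for h
    proof -
      have "boundary (chain_of u) {apex h (c e'), pole True (r (pv e'))} =
          chain_of u {apex h (c e'), pole True (r (pv e')), mid h (r (pv e'))} +
          chain_of u {apex h (c e'), pole True (r (pv e')), seam e'}"
        by (rule pair [OF _ link_apex_south [OF e'(1)]])
          (simp_all add: adj_commute [of "apex _ _"] adj_pole_pv_apex e'(1))
      moreover have "c e' = c e" using c_pv [OF e'(1)] e'(2) by simp
      ultimately show ?thesis
        using chain_of_triangle(3) [OF e'(1), of u h] chain_of_triangle(1) [OF e(1), of u h True] e'(2)
        by (simp add: insert_commute [of "pole _ _"])
    qed
    have sn: "boundary (chain_of u) {seam e, pole False (r e)} = 0"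
      by (subst pair [OF _ link_seam_north [OF e(1)]])
        (use e in \<open>simp_all add: adj_commute [of "seam _"] adj_north_seam
          chain_of_triangle insert_commute [of _ "apex _ _"]\<close>)
    have ss: "boundary (chain_of u) {seam e, pole True (r (pv e))} = 0"
      by (subst pair [OF _ link_seam_south [OF e(1)]])
        (use e in \<open>simp_all add: adj_commute [of "seam _"] adj_south_seam
          chain_of_triangle insert_commute [of _ "apex _ _"]\<close>)
    show ?thesis using e(2) mp as am an as' sn ss by (auto simp: edge_list_def)
  qed
  thus ?thesis using \<open>adj v w\<close> vw(1) by (metis adj_def insert_commute)
qed

text \<open>A cycle has equal coefficients on the two triangles at an edge that lies in no others.
  Crossing such edges leads through the entire sphere of a column, so all its coefficients agree
  with that of a reference triangle at the column representative.\<close>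

lemma cycle_values:
  assumes z: "z \<in> cycles K 2"
  shows "e < m \<Longrightarrow> z {apex h (c e), mid h (r e), pole a (r e)} = z {apex False (c e), seam (c e), pole False (r (c e))}"
    and "e < m \<Longrightarrow> z {apex h (c e), seam e, pole False (r e)} = z {apex False (c e), seam (c e), pole False (r (c e))}"
    and "e < m \<Longrightarrow> z {apex h (c e), seam e, pole True (r (pv e))} = z {apex False (c e), seam (c e), pole False (r (c e))}"
proof -
  have zc: "z \<in> carrier (chains K 2)" and bd: "boundary z \<tau> = 0" for \<tau>
    using z by (auto simp: cycles_def)
  \<comment> \<open>The coefficient at the seam of \<open>e\<close> in disc \<open>h\<close>. It is
    carried across the triangles of the entry, then to the neighbouring entry, and finally to the
    other disc.\<close>
  define \<beta> where "\<beta> h e = z {apex h (c e), seam e, pole False (r e)}" for h e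
  have pair: "z {u, v, x} = z {u, v, y}"
    if "adj v u" "{x. adj x u \<and> adj x v} = {x, y}" "x \<noteq> y" for u v x y
    using boundary_link_pair [OF zc _ that(2,3)] that(1) bd
    by (simp add: bit_add_eq_0_iff adj_commute)
  have south: "z {apex h (c e), seam e, pole True (r (pv e))} = \<beta> h e" if e: "e < m" for h e
    using pair [OF _ link_apex_seam [OF e, of h]] adj_seam_apex [OF e] by (simp add: \<beta>_def)
  have mid: "z {apex h (c e), mid h (r e), pole a (r e)} = \<beta> h e" if e: "e < m" for h a e
  proof -
    have "z {apex h (c e), pole False (r e), mid h (r e)} = z {apex h (c e), pole False (r e), seam e}"
      using pair [OF _ link_apex_north [OF e, of h]] adj_pole_apex [OF e] by simp
    hence "z {apex h (c e), mid h (r e), pole False (r e)} = \<beta> h e"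
      by (simp add: \<beta>_def insert_commute)
    moreover have "z {apex h (c e), mid h (r e), pole False (r e)} = z {apex h (c e), mid h (r e), pole True (r e)}"
      using pair [OF _ link_apex_mid [OF e, of h]] adj_mid_apex [OF e] by simp
    ultimately show ?thesis by (cases a) simp_all
  qed
  have "\<beta> h (pv e) = \<beta> h e" if e: "e < m" for h e
  proof -
    have "z {apex h (c e), pole True (r (pv e)), mid h (r (pv e))} = z {apex h (c e), pole True (r (pv e)), seam e}"
      using pair [OF _ link_apex_south [OF e, of h]] adj_pole_pv_apex [OF e] by simp
    thus ?thesis
      using south [OF e, of h] mid [OF pv_less [OF e], of h True] c_pv [OF e]
      by (simp add: insert_commute)
  qed
  \<comment> \<open>Invariance under \<open>pv\<close> means constancy on columns, because
    \<open>pv\<close> is a single cycle on each column.\<close>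
  hence "\<beta> h e = \<beta> h (c e)" if "e < m" for h e using pv_connected that by blast
  \<comment> \<open>The two discs share the seams, so front and back agree.\<close>
  moreover have "\<beta> True e = \<beta> False e" if e: "e < m" for e
    using pair [OF _ link_seam_north [OF e]] adj_commute adj_north_seam [OF e]
    by (simp add: \<beta>_def insert_commute)
  ultimately have *: "\<beta> h e = \<beta> False (c e)" if "e < m" for h e using that by (metis (full_types))
  show "e < m \<Longrightarrow> z {apex h (c e), mid h (r e), pole a (r e)} = z {apex False (c e), seam (c e), pole False (r (c e))}"
    "e < m \<Longrightarrow> z {apex h (c e), seam e, pole False (r e)} = z {apex False (c e), seam (c e), pole False (r (c e))}"
    "e < m \<Longrightarrow> z {apex h (c e), seam e, pole True (r (pv e))} = z {apex False (c e), seam (c e), pole False (r (c e))}"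
    using mid south * [of e h] by (simp_all add: \<beta>_def c_c)
qed

text \<open>The inverse reads off the coefficient at the reference triangle of each column.\<close>

lemma bij_betw_chain_of: "bij_betw chain_of (null_vectors m r c) (cycles K 2)"
proof (rule bij_betw_byWitness)
  let ?g = "\<lambda>z k. if k \<in> c ` {..<m} then z {apex False k, seam k, pole False (r k)} else 0 :: bit"
  have val: "chain_of u {apex False (c e), seam (c e), pole False (r (c e))} = u (c e)" if "e < m" for u e
    using chain_of_triangle(2) [OF c_less [OF that], of u False] c_c [OF that] by simp
  show "\<forall>u\<in>null_vectors m r c. ?g (chain_of u) = u"
    by (auto simp: null_vectors_def fun_eq_iff val)
  have g_c: "?g z (c e) = z {apex False (c e), seam (c e), pole False (r (c e))}" if "e < m" for z e
    using that by simp
  show "\<forall>z\<in>cycles K 2. chain_of (?g z) = z"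
  proof (intro ballI ext)
    fix z \<sigma> assume z: "z \<in> cycles K 2"
    show "chain_of (?g z) \<sigma> = z \<sigma>"
    proof (cases "\<sigma> \<in> simplices K 2")
      case True
      thus ?thesis
        by (cases rule: triangle_cases)
          (simp_all only: chain_of_triangle g_c cycle_values [OF z])
    next
      case False
      hence "z \<sigma> = 0" using z by (auto simp: cycles_def chains_def free_space_def)
      thus ?thesis using False by (simp add: chain_of_def)
    qed
  qed
  show "chain_of ` null_vectors m r c \<subseteq> cycles K 2"
    using chain_of_in_chains boundary_chain_of by (auto simp: cycles_def fun_eq_iff)
  show "?g ` cycles K 2 \<subseteq> null_vectors m r c"
  proof
    fix u assume "u \<in> ?g ` cycles K 2"
    then obtain z where z: "z \<in> cycles K 2" "u = ?g z" by (rule imageE)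
    hence zc: "z \<in> carrier (chains K 2)" and bd: "boundary z \<tau> = 0" for \<tau>
      by (auto simp: cycles_def)
    have "(\<Sum>e' | e' < m \<and> r e' = r e. u (c e')) = 0" if e: "e < m" for e
    proof -
      \<comment> \<open>One edge of the row circle suffices to recover the row sum as a boundary
        coefficient.\<close>
      have "(\<Sum>e' | e' < m \<and> r e' = r e. u (c e')) =
          boundary z {mid False (r e), pole False (r e)}"
        unfolding boundary_mid_pole [OF zc e]
      proof (rule sum.cong [OF refl])
        fix e' assume "e' \<in> {e'. e' < m \<and> r e' = r e}"
        hence "e' < m" by simp
        thus "u (c e') = z {apex False (c e'), mid False (r e'), pole False (r e')}"
          by (simp only: z(2) g_c cycle_values(1) [OF z(1)])
      qed
      thus ?thesis using bd by simp
    qed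
    thus "u \<in> null_vectors m r c" using z(2) by (simp add: null_vectors_def)
  qed
qed

text \<open>The interval is \<open>[1/4, 1/2)\<close>, and the margin 1/16 is a quarter of its
  length, which yields the thresholds 5/16 and 7/16.\<close>

lemma card_null_vectors_eq_long_bars:
  assumes B: "barcode_of B (vr_homology {..<7 * m} dist 2)"
    and C: "bottleneck_dist C B \<le> ereal \<epsilon>" "\<epsilon> < 1 / 16"
  shows "card (null_vectors m r c) = 2 ^ size {#I \<in># C. fst I < 5 / 16 \<and> ereal (7 / 16) < snd I#}"
proof -
  have K3: "simplices K (2 + 1) = {}" using simplices_K_3 by simp
  let ?M = "vr_homology {..<7 * m} dist 2"
  have triv: "\<exists>x. carrier (space_at ?M t) = {x}" if "0 \<le> t" "t < 1 / 4" for t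
    using homology_trivial [OF vietoris_rips_discrete [OF that, of 2]] by (simp add: vr_homology_def)
  have const: "carrier (space_at ?M t) = carrier (homology K 2)" if "1 / 4 \<le> t" "t < 1 / 2" for t
    using vietoris_rips_eq_K [OF that] by (simp add: vr_homology_def)
  have shift: "shift ?M s t x = x"
    if "1 / 4 \<le> s" "s \<le> t" "t < 1 / 2" "x \<in> carrier (homology K 2)" for s t x
  proof -
    have "1 / 4 \<le> t" using that by linarith
    thus ?thesis
      using vietoris_rips_eq_K [of t] that homology_inclusion_no_simplices [OF K3]
      by (simp add: vr_homology_def)
  qed
  note interval = barcode_of_constant_on_interval
    [OF B, of "1 / 4" "1 / 2" "carrier (homology K 2)", OF _ _ triv const shift]
  have long: "fst I = 1 / 4 \<and> ereal (1 / 2) \<le> snd I" if "I \<in># B" "fst I < 1 / 2" for I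
    by (rule interval(1)) (use that in simp_all)
  have "card (null_vectors m r c) = card (carrier (homology K 2))"
    using bij_betw_same_card [OF bij_betw_chain_of]
    by (simp add: homology_carrier_no_simplices [OF K3] card_image)
  also have "\<dots> = 2 ^ size {#I \<in># B. fst I < 1 / 2#}"
    by (rule interval(2)) simp_all
  also have "size {#I \<in># B. fst I < 1 / 2#} = size {#I \<in># C. fst I < 5 / 16 \<and> ereal (7 / 16) < snd I#}"
    using size_filter_bottleneck [OF C, where b = "1 / 2" and a = "1 / 4"] long by simp
  finally show ?thesis .
qed

end

section \<open>Programs and their running times\<close>

text \<open>Times are kept as upper bounds, so that both branches of a conditional and all
  iterations of a loop can share one bound.\<close>

definition runs ::
    "nat \<Rightarrow> nat \<Rightarrow> (nat \<Rightarrow> nat \<Rightarrow> real) \<Rightarrow> com \<Rightarrow> state \<Rightarrow> nat \<Rightarrow> state \<Rightarrow> bool" where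
  "runs W n d p s T s' \<longleftrightarrow> (\<exists>t\<le>T. exec W n d p s t s')"

lemma runs_mono: "runs W n d p s T s' \<Longrightarrow> T \<le> T' \<Longrightarrow> runs W n d p s T' s'"
  unfolding runs_def using le_trans by blast

lemma runs_Skip: "runs W n d Skip s 1 s"
  unfolding runs_def using exec_Skip by blast

lemma runs_ISet:
  assumes "iok W s e"
  shows "runs W n d (ISet x e) s 1 (s\<lparr>ivar := (ivar s)(x := ival s e)\<rparr>)"
  unfolding runs_def using exec_ISet [OF assms] by blast

lemma runs_IPut:
  assumes "iok W s i" "iok W s e"
  shows "runs W n d (IPut a i e) s 1 (s\<lparr>iarr := (iarr s)(a := (iarr s a)(ival s i := ival s e))\<rparr>)"
  unfolding runs_def using exec_IPut [OF assms] by blast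

lemma runs_RPut:
  assumes "iok W s i" "rok W n s e"
  shows "runs W n d (RPut a i e) s 1 (s\<lparr>rarr := (rarr s)(a := (rarr s a)(ival s i := rval d s e))\<rparr>)"
  unfolding runs_def using exec_RPut [OF assms] by blast

lemma runs_Seq:
  assumes "runs W n d p s T s'" "runs W n d p' s' T' s''"
  shows "runs W n d (Seq p p') s (T + T') s''"
  using assms unfolding runs_def by (meson add_mono exec_Seq)

lemma runs_Cond:
  assumes "test_ok W n s b" "holds d s b \<Longrightarrow> runs W n d p s T s'" "\<not> holds d s b \<Longrightarrow> runs W n d p' s T s'"
  shows "runs W n d (Cond b p p') s (1 + T) s'"
  using assms unfolding runs_def
  by (cases "holds d s b") (meson add_left_mono exec_Cond_True exec_Cond_False)+

text \<open>The explicit states \<open>\<sigma> i\<close> after \<open>i\<close> iterations take the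
  place of an invariant. Each iteration pays one unit for its test, and the failing test gives the
  final \<open>+ 1\<close>.\<close>

lemma runs_While:
  assumes "\<And>i. i < k \<Longrightarrow> test_ok W n (\<sigma> i) b \<and> holds d (\<sigma> i) b \<and> runs W n d p (\<sigma> i) T (\<sigma> (Suc i))"
    and "test_ok W n (\<sigma> k) b" "\<not> holds d (\<sigma> k) b"
  shows "runs W n d (While b p) (\<sigma> 0) (k * (T + 1) + 1) (\<sigma> k)"
proof -
  have "runs W n d (While b p) (\<sigma> j) ((k - j) * (T + 1) + 1) (\<sigma> k)" if "j \<le> k" for j
    using that
  proof (induction rule: inc_induct)
    case base
    show ?case unfolding runs_def using exec_While_False [OF assms(2,3)] by auto
  next
    case (step j)
    from assms(1) [OF step.hyps(2)] obtain t where t: "t \<le> T" "exec W n d p (\<sigma> j) t (\<sigma> (Suc j))"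
      and b: "test_ok W n (\<sigma> j) b" "holds d (\<sigma> j) b" by (auto simp: runs_def)
    from step.IH obtain t' where t': "t' \<le> (k - Suc j) * (T + 1) + 1" "exec W n d (While b p) (\<sigma> (Suc j)) t' (\<sigma> k)"
      by (auto simp: runs_def)
    have "k - j = Suc (k - Suc j)" using step.hyps(2) by simp
    hence "1 + t + t' \<le> (k - j) * (T + 1) + 1" using t(1) t'(1) by simp
    thus ?case unfolding runs_def using exec_While_True [OF b t(2) t'(2)] by blast
  qed
  from this [of 0] show ?thesis by simp
qed

lemma ival_rarr [simp]: "ival (s\<lparr>rarr := A\<rparr>) e = ival s e"
  by (induction e) simp_all

lemma iok_rarr [simp]: "iok W (s\<lparr>rarr := A\<rparr>) e = iok W s e"
  by (induction e) simp_all

text \<open>A step writes at most one cell. This will bound the number of output bars, a word that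
  could otherwise exceed the running time by far.\<close>

lemma exec_nonzero_entries:
  assumes "exec W n d p s t s'" "finite {i. rarr s a i \<noteq> 0}"
  shows "finite {i. rarr s' a i \<noteq> 0} \<and> card {i. rarr s' a i \<noteq> 0} \<le> card {i. rarr s a i \<noteq> 0} + t"
  using assms
proof (induction rule: exec.induct)
  case (exec_RPut s i e b)
  let ?S = "{k. rarr s a k \<noteq> 0}"
  let ?s' = "s\<lparr>rarr := (rarr s)(b := (rarr s b)(ival s i := rval d s e))\<rparr>"
  have sub: "{k. rarr ?s' a k \<noteq> 0} \<subseteq> insert (ival s i) ?S" by auto
  have fin: "finite (insert (ival s i) ?S)" using exec_RPut.prems by simp
  have "card (insert (ival s i) ?S) \<le> card ?S + 1"
    using exec_RPut.prems by (simp add: card_insert_if)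
  thus ?case using finite_subset [OF sub fin] card_mono [OF fin sub] by linarith
next
  case (exec_Seq p s t s' p' t' s'')
  thus ?case by fastforce
next
  case (exec_While_True s b p t s' t' s'')
  thus ?case by fastforce
qed simp_all

section \<open>Simulation of the distance oracle by a table\<close>

text \<open>
  The distance \<open>d u v\<close> is tabulated in real array \<open>0\<close>, with row length in word register \<open>1\<close>. The
  table is not symmetrised; the zeros on the diagonal are produced by truncated subtraction.
\<close>

definition dist_exp :: "iexp \<Rightarrow> iexp \<Rightarrow> rexp" where
  "dist_exp u v = RSub (RSub
     (RInt (ISub (ICon 1) (ISub (ICon 1) (IAdd (ISub u v) (ISub v u)))))
     (RGet 0 (IAdd (IMul u (IVar 1)) v)))
     (RGet 0 (IAdd (IMul v (IVar 1)) u))"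

text \<open>The registers and arrays below \<open>8\<close> are left to the program that simulates \<open>p\<close> by \<open>ren p\<close>.\<close>

fun ren_i :: "iexp \<Rightarrow> iexp" where
  "ren_i (ICon k) = ICon k"
| "ren_i (IVar x) = IVar (x + 8)"
| "ren_i (IGet a e) = IGet (a + 8) (ren_i e)"
| "ren_i (IAdd e f) = IAdd (ren_i e) (ren_i f)"
| "ren_i (ISub e f) = ISub (ren_i e) (ren_i f)"
| "ren_i (IMul e f) = IMul (ren_i e) (ren_i f)"
| "ren_i (IDiv e f) = IDiv (ren_i e) (ren_i f)"
| "ren_i (IMod e f) = IMod (ren_i e) (ren_i f)"

fun ren_r :: "rexp \<Rightarrow> rexp" where
  "ren_r (RVar x) = RVar (x + 8)"
| "ren_r (RGet a e) = RGet (a + 8) (ren_i e)"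
| "ren_r (RInt e) = RInt (ren_i e)"
| "ren_r (RAdd e f) = RAdd (ren_r e) (ren_r f)"
| "ren_r (RSub e f) = RSub (ren_r e) (ren_r f)"
| "ren_r (RMul e f) = RMul (ren_r e) (ren_r f)"
| "ren_r (RDiv e f) = RDiv (ren_r e) (ren_r f)"
| "ren_r (Dist e f) = dist_exp (ren_i e) (ren_i f)"

fun ren_test :: "test \<Rightarrow> test" where
  "ren_test (ILess e f) = ILess (ren_i e) (ren_i f)"
| "ren_test (RLess e f) = RLess (ren_r e) (ren_r f)"

fun ren :: "com \<Rightarrow> com" where
  "ren Skip = Skip"
| "ren (ISet x e) = ISet (x + 8) (ren_i e)"
| "ren (IPut a i e) = IPut (a + 8) (ren_i i) (ren_i e)"
| "ren (RSet x e) = RSet (x + 8) (ren_r e)"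
| "ren (RPut a i e) = RPut (a + 8) (ren_i i) (ren_r e)"
| "ren (Seq p q) = Seq (ren p) (ren q)"
| "ren (Cond b p q) = Cond (ren_test b) (ren p) (ren q)"
| "ren (While b p) = While (ren_test b) (ren p)"

text \<open>The memory as seen by the simulated program; the simulation relation is equality with
  \<open>proj\<close>.\<close>

definition proj :: "state \<Rightarrow> state" where
  "proj \<sigma> = \<lparr>ivar = \<lambda>x. ivar \<sigma> (x + 8), rvar = \<lambda>x. rvar \<sigma> (x + 8),
    iarr = \<lambda>a. iarr \<sigma> (a + 8), rarr = \<lambda>a. rarr \<sigma> (a + 8)\<rparr>"

definition tabulates :: "state \<Rightarrow> nat \<Rightarrow> (nat \<Rightarrow> nat \<Rightarrow> real) \<Rightarrow> bool" where
  "tabulates \<sigma> n d \<longleftrightarrow> ivar \<sigma> 1 = n \<and>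
    (\<forall>u<n. \<forall>v<n. d u v = (if u = v then 0 else 1) - rarr \<sigma> 0 (u * n + v) - rarr \<sigma> 0 (v * n + u))"

definition same_low :: "state \<Rightarrow> state \<Rightarrow> bool" where
  "same_low \<sigma> \<sigma>' \<longleftrightarrow> (\<forall>x<8. ivar \<sigma>' x = ivar \<sigma> x) \<and> rarr \<sigma>' 0 = rarr \<sigma> 0"

lemma ival_ren_i [simp]: "ival \<sigma> (ren_i e) = ival (proj \<sigma>) e"
  by (induction e) (simp_all add: proj_def)

lemma iok_ren_i: "iok W (proj \<sigma>) e \<Longrightarrow> W \<le> W' \<Longrightarrow> iok W' \<sigma> (ren_i e)"
  by (induction e) auto

lemma index_less_square:
  assumes "u < n" "v < (n :: nat)"
  shows "u * n + v < n * n"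
proof -
  have "u * n + v < Suc u * n" using assms(2) by simp
  also have "\<dots> \<le> n * n" using assms(1) by (intro mult_le_mono1) simp
  finally show ?thesis .
qed

lemma ren_r:
  assumes "rok W n (proj \<sigma>) e" "tabulates \<sigma> n d" "W \<le> W'" "n * n + 1 \<le> W'"
  shows "rval d' \<sigma> (ren_r e) = rval d (proj \<sigma>) e \<and> rok W' n' \<sigma> (ren_r e)"
  using assms(1)
proof (induction e)
  case (Dist e f)
  let ?u = "ival (proj \<sigma>) e" and ?v = "ival (proj \<sigma>) f"
  have uv: "?u < n" "?v < n" and ok: "iok W' \<sigma> (ren_i e)" "iok W' \<sigma> (ren_i f)"
    using Dist iok_ren_i assms(3) by auto
  have "?u * n + ?v < n * n" "?v * n + ?u < n * n" using uv index_less_square by auto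
  moreover have "?u - ?v + (?v - ?u) \<le> n" "n \<le> n * n" using uv by auto
  ultimately show ?case
    using uv ok assms(2,4) by (auto simp: dist_exp_def tabulates_def)
qed (use assms(3) iok_ren_i in \<open>auto simp: proj_def\<close>)

lemma ren_test:
  assumes "test_ok W n (proj \<sigma>) b" "tabulates \<sigma> n d" "W \<le> W'" "n * n + 1 \<le> W'"
  shows "holds d' \<sigma> (ren_test b) = holds d (proj \<sigma>) b \<and> test_ok W' n' \<sigma> (ren_test b)"
  using assms by (cases b) (auto simp: iok_ren_i ren_r [where W = W and d = d])

lemma tabulates_same_low: "tabulates \<sigma> n d \<Longrightarrow> same_low \<sigma> \<sigma>' \<Longrightarrow> tabulates \<sigma>' n d"
  by (simp add: tabulates_def same_low_def)

lemma same_low_trans: "same_low \<sigma> \<sigma>' \<Longrightarrow> same_low \<sigma>' \<sigma>'' \<Longrightarrow> same_low \<sigma> \<sigma>''"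
  by (simp add: same_low_def)

text \<open>The simulation takes exactly the same time, because a query becomes an expression within
  the same assignment or test. No query remains, so the oracle \<open>d'\<close> and the number
  \<open>n'\<close> of the host machine are arbitrary.\<close>

lemma exec_ren:
  assumes "exec W n d p s t s'" "s = proj \<sigma>" "tabulates \<sigma> n d" "W \<le> W'" "n * n + 1 \<le> W'"
  shows "\<exists>\<sigma>'. exec W' n' d' (ren p) \<sigma> t \<sigma>' \<and> proj \<sigma>' = s' \<and> same_low \<sigma> \<sigma>'"
  using assms(1-3)
proof (induction arbitrary: \<sigma> rule: exec.induct)
  case (exec_Skip s)
  show ?case
    using exec_Skip exec.exec_Skip [of W' n' d' \<sigma>] by (auto simp: same_low_def)
next
  case (exec_ISet s e x)
  show ?case
    by (rule exI, rule conjI, unfold ren.simps, rule exec.exec_ISet)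
      (use exec_ISet assms(4) in \<open>auto simp: iok_ren_i proj_def same_low_def fun_eq_iff\<close>)
next
  case (exec_IPut s i e a)
  show ?case
    by (rule exI, rule conjI, unfold ren.simps, rule exec.exec_IPut)
      (use exec_IPut assms(4) in \<open>auto simp: iok_ren_i proj_def same_low_def fun_eq_iff\<close>)
next
  case (exec_RSet s e x)
  note ren = ren_r [OF exec_RSet(1) [unfolded exec_RSet(2)] exec_RSet(3) assms(4,5)]
  show ?case
    by (rule exI, rule conjI, unfold ren.simps, rule exec.exec_RSet)
      (use exec_RSet ren in \<open>auto simp: proj_def same_low_def fun_eq_iff\<close>)
next
  case (exec_RPut s i e a)
  note ren = ren_r [OF exec_RPut(2) [unfolded exec_RPut(3)] exec_RPut(4) assms(4,5)]
  show ?case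
    by (rule exI, rule conjI, unfold ren.simps, rule exec.exec_RPut)
      (use exec_RPut assms(4) ren in \<open>auto simp: iok_ren_i proj_def same_low_def fun_eq_iff\<close>)
next
  case (exec_Seq c s t s' c' t' s'')
  obtain \<sigma>1 where 1: "exec W' n' d' (ren c) \<sigma> t \<sigma>1" "proj \<sigma>1 = s'" "same_low \<sigma> \<sigma>1"
    using exec_Seq.IH(1) [OF exec_Seq.prems] by blast
  obtain \<sigma>2 where 2: "exec W' n' d' (ren c') \<sigma>1 t' \<sigma>2" "proj \<sigma>2 = s''" "same_low \<sigma>1 \<sigma>2"
    using exec_Seq.IH(2) [OF 1(2) [symmetric] tabulates_same_low [OF exec_Seq.prems(2) 1(3)]] by blast
  show ?case
    using exec.exec_Seq [OF 1(1) 2(1)] 2(2) same_low_trans [OF 1(3) 2(3)] by auto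
next
  case (exec_Cond_True s b c t s' c')
  note ren = ren_test [OF exec_Cond_True(1) [unfolded exec_Cond_True(5)] exec_Cond_True(6) assms(4,5)]
  obtain \<sigma>1 where 1: "exec W' n' d' (ren c) \<sigma> t \<sigma>1" "proj \<sigma>1 = s'" "same_low \<sigma> \<sigma>1"
    using exec_Cond_True.IH [OF exec_Cond_True.prems] by blast
  show ?case
    using exec.exec_Cond_True [OF _ _ 1(1), of "ren_test b" "ren c'"] ren exec_Cond_True 1 by auto
next
  case (exec_Cond_False s b c' t s' c)
  note ren = ren_test [OF exec_Cond_False(1) [unfolded exec_Cond_False(5)] exec_Cond_False(6) assms(4,5)]
  obtain \<sigma>1 where 1: "exec W' n' d' (ren c') \<sigma> t \<sigma>1" "proj \<sigma>1 = s'" "same_low \<sigma> \<sigma>1"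
    using exec_Cond_False.IH [OF exec_Cond_False.prems] by blast
  show ?case
    using exec.exec_Cond_False [OF _ _ 1(1), of "ren_test b" "ren c"] ren exec_Cond_False 1 by auto
next
  case (exec_While_False s b c)
  note ren = ren_test [OF exec_While_False(1) [unfolded exec_While_False(3)] exec_While_False(4) assms(4,5)]
  show ?case
    using exec.exec_While_False [of W' n' \<sigma> "ren_test b" d' "ren c"] ren exec_While_False
    by (auto simp: same_low_def)
next
  case (exec_While_True s b c t s' t' s'')
  note ren = ren_test [OF exec_While_True(1) [unfolded exec_While_True(7)] exec_While_True(8) assms(4,5)]
  obtain \<sigma>1 where 1: "exec W' n' d' (ren c) \<sigma> t \<sigma>1" "proj \<sigma>1 = s'" "same_low \<sigma> \<sigma>1"
    using exec_While_True.IH(1) [OF exec_While_True.prems] by blast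
  obtain \<sigma>2 where 2: "exec W' n' d' (ren (While b c)) \<sigma>1 t' \<sigma>2" "proj \<sigma>2 = s''" "same_low \<sigma>1 \<sigma>2"
    using exec_While_True.IH(2) [OF 1(2) [symmetric] tabulates_same_low [OF exec_While_True.prems(2) 1(3)]]
    by blast
  show ?case
    using exec.exec_While_True [OF _ _ 1(1), of "ren_test b" t' \<sigma>2] 2 ren exec_While_True.hyps(1,2)
      exec_While_True.prems same_low_trans [OF 1(3) 2(3)] by auto
qed

section \<open>The rank program\<close>

text \<open>Starting the second scan from the table of last entries gives the first entry of a
  column its last entry as predecessor, which closes the column to a cycle.\<close>

definition prev_in_column :: "nat \<Rightarrow> (nat \<Rightarrow> nat) \<Rightarrow> nat \<Rightarrow> nat" where
  "prev_in_column m f e = latest f (latest f (\<lambda>_. 0) m) e (f e)"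

lemma prev_in_column:
  assumes "e < m"
  shows "prev_in_column m f e < m" "f (prev_in_column m f e) = f e"
    and "prev_in_column m f e < e \<or> prev_in_column m f e = rep m f e \<and> (\<forall>k<e. f k \<noteq> f e)"
    and "k < e \<Longrightarrow> f k = f e \<Longrightarrow> k \<le> prev_in_column m f e"
  using rep [OF assms, of f] assms
  by (cases rule: latest_cases [where e = e and f = f and j = "f e" and a = "latest f (\<lambda>_. 0) m"];
      force simp: prev_in_column_def rep_def)+

lemma incidence_entries:
  assumes inj: "\<And>e e'. e < m \<Longrightarrow> e' < m \<Longrightarrow> f e = f e' \<Longrightarrow> g e = g e' \<Longrightarrow> e = e'"
  shows "incidence m (rep m f) (rep m g) (prev_in_column m g)"
proof
  let ?p = "prev_in_column m g"
  show "rep m f e < m" "rep m g e < m" "?p e < m" if "e < m" for e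
    using rep [OF that] prev_in_column [OF that] by auto
  show "rep m g (rep m g e) = rep m g e" "rep m g (?p e) = rep m g e" if "e < m" for e
    using rep(2) [OF that, of g] prev_in_column(2) [OF that, of g] by (simp_all only: rep_def)
  show "e = e'" if "e < m" "e' < m" "rep m f e = rep m f e'" "rep m g e = rep m g e'" for e e'
    using that inj by (simp add: rep_eq_iff)
  \<comment> \<open>The predecessor of the later entry \<open>e'\<close> lies in
    \<open>[e, e')\<close>. That of \<open>e\<close> is either before \<open>e\<close> or the last
    entry of the column, which is not before \<open>e'\<close>.\<close>
  have "\<not> e < e'" if e: "e < m" "e' < m" "?p e = ?p e'" for e e'
  proof
    assume "e < e'"
    have ge: "g e = g e'" using prev_in_column(2) [OF e(1), of g] prev_in_column(2) [OF e(2), of g] e(3) by simp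
    hence "e \<le> ?p e'" using prev_in_column(4) [OF e(2)] \<open>e < e'\<close> by blast
    moreover have "?p e' < e'" using prev_in_column(3) [OF e(2), of g] ge \<open>e < e'\<close> by blast
    moreover have "e' \<le> rep m g e" using rep(3) [OF e(2), of g] ge by (simp add: rep_def)
    ultimately show False using prev_in_column(3) [OF e(1), of g] e(3) by linarith
  qed
  thus "e = e'" if "e < m" "e' < m" "?p e = ?p e'" for e e'
    using that by (metis linorder_neqE_nat)
  fix \<beta> :: "nat \<Rightarrow> bit" and e
  assume \<beta>: "\<And>e. e < m \<Longrightarrow> \<beta> (?p e) = \<beta> e"
  show "e < m \<Longrightarrow> \<beta> e = \<beta> (rep m g e)"
  proof (induction e rule: less_induct)
    case (less e)
    \<comment> \<open>Following predecessors descends until it wraps around to the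
      representative.\<close>
    have "?p e < e \<or> ?p e = rep m g e" using prev_in_column(3) [OF less.prems] by blast
    thus ?case
    proof
      assume "?p e < e"
      hence "\<beta> (?p e) = \<beta> (rep m g (?p e))" using less.IH less.prems by simp
      thus ?thesis using \<beta> [OF less.prems] prev_in_column(2) [OF less.prems, of g] by (simp add: rep_def)
    qed (use \<beta> [OF less.prems] in simp)
  qed
qed

text \<open>These rules push the state forward through a sequence of assignments while counting down
  the time budget.\<close>

lemma runs_ISet_Seq:
  assumes "iok W s e" "0 < T" "runs W n d p (s\<lparr>ivar := (ivar s)(x := ival s e)\<rparr>) (T - 1) s'"
  shows "runs W n d (Seq (ISet x e) p) s T s'"
  using runs_Seq [OF runs_ISet [OF assms(1)] assms(3)] assms(2) by simp

lemma runs_IPut_Seq: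
  assumes "iok W s i" "iok W s e" "0 < T"
    and "runs W n d p (s\<lparr>iarr := (iarr s)(a := (iarr s a)(ival s i := ival s e))\<rparr>) (T - 1) s'"
  shows "runs W n d (Seq (IPut a i e) p) s T s'"
  using runs_Seq [OF runs_IPut [OF assms(1,2)] assms(4)] assms(3) by simp

lemma runs_ISet_last:
  assumes "iok W s e" "0 < T" "s\<lparr>ivar := (ivar s)(x := ival s e)\<rparr> = s'"
  shows "runs W n d (ISet x e) s T s'"
  using runs_mono [OF runs_ISet [OF assms(1)], where T' = T] assms(2,3) by fastforce

section \<open>The text of the rank program\<close>

definition row_rep :: iexp where "row_rep = IGet 2 (IGet 0 (IVar 2))"
definition col_rep :: iexp where "col_rep = IGet 3 (IGet 1 (IVar 2))"
definition prev_row_rep :: iexp where "prev_row_rep = IGet 2 (IGet 0 (IGet 4 (IGet 1 (IVar 2))))"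

definition point :: "nat \<Rightarrow> iexp \<Rightarrow> iexp" where "point k e = IAdd (IMul (ICon 7) e) (ICon k)"

definition edge_exps :: "(iexp \<times> iexp) list" where
  "edge_exps =
    [(point 4 (IVar 2), point 0 row_rep), (point 4 (IVar 2), point 1 prev_row_rep),
     (point 2 row_rep, point 0 row_rep), (point 2 row_rep, point 1 row_rep),
     (point 3 row_rep, point 0 row_rep), (point 3 row_rep, point 1 row_rep),
     (point 5 col_rep, point 0 row_rep), (point 5 col_rep, point 1 row_rep),
     (point 6 col_rep, point 0 row_rep), (point 6 col_rep, point 1 row_rep),
     (point 5 col_rep, point 2 row_rep), (point 6 col_rep, point 3 row_rep),
     (point 5 col_rep, point 4 (IVar 2)), (point 6 col_rep, point 4 (IVar 2))]"

definition mark :: "(iexp \<times> iexp) list \<Rightarrow> com" where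
  "mark ps = foldr (\<lambda>(u, v). Seq (RPut 0 (IAdd (IMul u (IVar 1)) v) (RDiv (RInt (ICon 1)) (RInt (ICon 2))))) ps Skip"

lemma runs_mark:
  assumes "\<And>u v. (u, v) \<in> set ps \<Longrightarrow> iok W s (IAdd (IMul u (IVar 1)) v)" "2 \<le> W"
  shows "runs W n d (mark ps) s (length ps + 1)
    (s\<lparr>rarr := (rarr s)(0 := \<lambda>a. if a \<in> (\<lambda>(u, v). ival s u * ivar s 1 + ival s v) ` set ps then 1 / 2
      else rarr s 0 a)\<rparr>)"
  using assms(1)
proof (induction ps arbitrary: s)
  case Nil
  thus ?case using runs_Skip by (simp add: mark_def)
next
  case (Cons p ps)
  obtain u v where p: "p = (u, v)" by (cases p)
  let ?w = "IAdd (IMul u (IVar 1)) v" and ?half = "RDiv (RInt (ICon 1)) (RInt (ICon 2))"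
  let ?A = "\<lambda>s ps a. if a \<in> (\<lambda>(u, v). ival s u * ivar s 1 + ival s v) ` set ps then 1 / 2 else rarr s 0 a"
  let ?s = "s\<lparr>rarr := (rarr s)(0 := (rarr s 0)(ival s ?w := 1 / 2))\<rparr>"
  have first: "runs W n d (RPut 0 ?w ?half) s 1 ?s"
    using runs_RPut [of W s ?w n ?half d 0] Cons.prems [of u v] p assms(2) by simp
  have "?s\<lparr>rarr := (rarr ?s)(0 := ?A ?s ps)\<rparr> = s\<lparr>rarr := (rarr s)(0 := ?A s (p # ps))\<rparr>"
    by (simp add: p fun_eq_iff)
  moreover have "runs W n d (mark ps) ?s (length ps + 1) (?s\<lparr>rarr := (rarr ?s)(0 := ?A ?s ps)\<rparr>)"
  proof (rule Cons.IH)
    fix u' v' assume "(u', v') \<in> set ps"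
    thus "iok W ?s (IAdd (IMul u' (IVar 1)) v')" using Cons.prems [of u' v'] by simp
  qed
  ultimately have second: "runs W n d (mark ps) ?s (length ps + 1) (s\<lparr>rarr := (rarr s)(0 := ?A s (p # ps))\<rparr>)"
    by (simp only:)
  have len: "length (p # ps) + 1 = 1 + (length ps + 1)" by simp
  have mark: "mark (p # ps) = Seq (RPut 0 ?w ?half) (mark ps)" by (simp add: mark_def p)
  show ?case unfolding len mark by (rule runs_Seq [OF first second])
qed

text \<open>Arrays 0 and 1 hold the input, and arrays 2 and 3 receive the last entry of each row and
  column. Array 4 starts as a copy of array 3, to be overwritten by \<open>fill\<close>.\<close>

definition scan :: com where
  "scan = While (ILess (IVar 2) (IVar 0))
    (Seq (IPut 2 (IGet 0 (IVar 2)) (IVar 2)) (Seq (IPut 3 (IGet 1 (IVar 2)) (IVar 2))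
    (Seq (IPut 4 (IGet 1 (IVar 2)) (IVar 2)) (ISet 2 (IAdd (IVar 2) (ICon 1))))))"

text \<open>Array 4 is updated only after the edges are marked, so the marking reads the preceding
  entry of the column. Register 3 counts nonzero columns by their representatives; an entry never
  exceeds its representative, so a failing test means equality.\<close>

definition fill :: com where
  "fill = While (ILess (IVar 2) (IVar 0))
    (Seq (mark edge_exps)
    (Seq (Cond (ILess (IVar 2) col_rep) Skip (ISet 3 (IAdd (IVar 3) (ICon 1))))
    (Seq (IPut 4 (IGet 1 (IVar 2)) (IVar 2)) (ISet 2 (IAdd (IVar 2) (ICon 1))))))"

text \<open>Register 8 and arrays 8 and 9 are the output of the renamed program. Each long bar
  lowers the column count by one.\<close>

definition discount :: com where
  "discount = While (ILess (ICon 0) (IVar 8))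
    (Seq (ISet 8 (ISub (IVar 8) (ICon 1)))
    (Cond (RLess (RGet 8 (IVar 8)) (RDiv (RInt (ICon 5)) (RInt (ICon 16))))
      (Cond (RLess (RDiv (RInt (ICon 7)) (RInt (ICon 16))) (RGet 9 (IVar 8)))
        (ISet 3 (ISub (IVar 3) (ICon 1))) Skip)
      Skip))"

text \<open>Register 1 serves both as row length of the distance table and as the number of points
  passed to \<open>A\<close>.\<close>

definition rank_com :: "com \<Rightarrow> com" where
  "rank_com A = Seq (ISet 1 (IMul (ICon 7) (IVar 0))) (Seq (ISet 2 (ICon 0)) (Seq scan
    (Seq (ISet 2 (ICon 0)) (Seq fill (Seq (ISet 8 (IVar 1)) (Seq (ren A) (Seq discount (ISet 0 (IVar 3)))))))))"

section \<open>Correctness and running time of the rank program\<close>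

locale entry_list =
  fixes m :: nat and f g :: "nat \<Rightarrow> nat" and W :: nat
  assumes entry_inj: "e < m \<Longrightarrow> e' < m \<Longrightarrow> f e = f e' \<Longrightarrow> g e = g e' \<Longrightarrow> e = e'"
    and word: "(7 * m + 2) * (7 * m + 2) + 16 \<le> W"
begin

abbreviation "r \<equiv> rep m f"
abbreviation "c \<equiv> rep m g"
abbreviation "pv \<equiv> prev_in_column m g"

sublocale incidence m r c pv
  by (rule incidence_entries) (rule entry_inj)

lemma words: "49 * (m * m) + 28 * m + 20 \<le> W"
  using word by (simp add: algebra_simps)

definition scan_state :: "nat \<Rightarrow> state" where
  "scan_state e = \<lparr>ivar = (\<lambda>_. 0)(0 := m, 1 := 7 * m, 2 := e), rvar = (\<lambda>_. 0),
    iarr = (\<lambda>_ _. 0)(0 := f, 1 := g, 2 := latest f (\<lambda>_. 0) e, 3 := latest g (\<lambda>_. 0) e,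
      4 := latest g (\<lambda>_. 0) e), rarr = (\<lambda>_ _. 0)\<rparr>"

lemma runs_scan: "runs W n d scan (scan_state 0) (m * 5 + 1) (scan_state m)"
proof -
  have "runs W n d (Seq (IPut 2 (IGet 0 (IVar 2)) (IVar 2)) (Seq (IPut 3 (IGet 1 (IVar 2)) (IVar 2))
    (Seq (IPut 4 (IGet 1 (IVar 2)) (IVar 2)) (ISet 2 (IAdd (IVar 2) (ICon 1))))))
    (scan_state e) 4 (scan_state (Suc e))" if "e < m" for e
    by (intro runs_IPut_Seq runs_ISet_last)
      (use that words in \<open>simp_all add: scan_state_def fun_eq_iff\<close>)
  from runs_While [where T = 4, OF _ _ _, of m W n scan_state "ILess (IVar 2) (IVar 0)" d] this
  show ?thesis unfolding scan_def by (simp add: scan_state_def)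
qed

definition point_table :: "nat \<Rightarrow> nat \<Rightarrow> real" where
  "point_table e a = (if a \<in> (\<lambda>(u, v). u * (7 * m) + v) ` (\<Union>e'<e. set (edge_list r c pv e')) then 1 / 2 else 0)"

definition fill_state :: "nat \<Rightarrow> state" where
  "fill_state e = \<lparr>ivar = (\<lambda>_. 0)(0 := m, 1 := 7 * m, 2 := e, 3 := card {k. k < e \<and> c k = k}), rvar = (\<lambda>_. 0),
    iarr = (\<lambda>_ _. 0)(0 := f, 1 := g, 2 := latest f (\<lambda>_. 0) m, 3 := latest g (\<lambda>_. 0) m,
      4 := latest g (latest g (\<lambda>_. 0) m) e), rarr = (\<lambda>_ _. 0)(0 := point_table e)\<rparr>"

lemma fill_values:
  "ival (fill_state e) row_rep = r e" "ival (fill_state e) col_rep = c e"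
  "ival (fill_state e) prev_row_rep = r (pv e)"
  by (simp_all add: fill_state_def row_rep_def col_rep_def prev_row_rep_def rep_def prev_in_column_def)

lemma edge_exps_values:
  "map (\<lambda>(u, v). (ival (fill_state e) u, ival (fill_state e) v)) edge_exps = edge_list r c pv e"
  by (simp add: edge_exps_def edge_list_def fill_values point_def pole_def mid_def seam_def apex_def)
    (simp add: fill_state_def)

lemma runs_mark_edges:
  assumes "e < m"
  shows "runs W n d (mark edge_exps) (fill_state e) 15 ((fill_state e)\<lparr>rarr := (\<lambda>_ _. 0)(0 := point_table (Suc e))\<rparr>)"
proof -
  let ?s = "fill_state e"
  have "iok W ?s (IAdd (IMul u (IVar 1)) v)" if "(u, v) \<in> set edge_exps" for u v
  proof -
    have "(ival ?s u, ival ?s v) \<in> set (edge_list r c pv e)"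
      using that by (force simp flip: edge_exps_values)
    hence "ival ?s u < 7 * m" "ival ?s v < 7 * m"
      using adj_less [of "ival ?s u" "ival ?s v"] assms by (auto simp: adj_def edges_def)
    hence "ival ?s u * (7 * m) + ival ?s v < 7 * m * (7 * m)" by (rule index_less_square)
    moreover have pt: "iok W ?s (point k x)" if "k < 7" "iok W ?s x" "ival ?s x < m" for k x
      using that words by (simp add: point_def)
    have "iok W ?s row_rep" "iok W ?s col_rep" "iok W ?s prev_row_rep" "iok W ?s (IVar 2)" "ival ?s (IVar 2) < m"
      using assms by (simp_all add: row_rep_def col_rep_def prev_row_rep_def fill_state_def)
    hence "iok W ?s u" "iok W ?s v"
      using that r_less [OF assms] c_less [OF assms] r_less [OF pv_less [OF assms]]
      by (auto simp: edge_exps_def fill_values intro!: pt)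
    ultimately show ?thesis using words by (simp add: fill_state_def)
  qed
  \<comment> \<open>Fourteen edges and the final \<open>Skip\<close>.\<close>
  moreover have len: "length edge_exps + 1 = 15" by (simp add: edge_exps_def)
  moreover have "2 \<le> W" using words by simp
  ultimately have "runs W n d (mark edge_exps) ?s 15
    (?s\<lparr>rarr := (rarr ?s)(0 := \<lambda>a. if a \<in> (\<lambda>(u, v). ival ?s u * ivar ?s 1 + ival ?s v) ` set edge_exps then 1 / 2
      else rarr ?s 0 a)\<rparr>)"
    using runs_mark [of edge_exps W ?s n d, unfolded len] by blast
  moreover have "(\<lambda>(u, v). ival ?s u * ivar ?s 1 + ival ?s v) ` set edge_exps =
    (\<lambda>(u, v). u * (7 * m) + v) ` set (edge_list r c pv e)"
    unfolding edge_exps_values [symmetric] by (simp add: image_image case_prod_beta fill_state_def)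
  moreover have "(rarr ?s)(0 := \<lambda>a. if a \<in> (\<lambda>(u, v). u * (7 * m) + v) ` set (edge_list r c pv e) then 1 / 2
      else rarr ?s 0 a) = (\<lambda>_ _. 0)(0 := point_table (Suc e))"
    by (auto simp: fill_state_def point_table_def fun_eq_iff lessThan_Suc image_Un)
  ultimately show ?thesis by (simp only:)
qed

lemma runs_fill: "runs W n d fill (fill_state 0) (m * 20 + 1) (fill_state m)"
proof -
  let ?c = "Cond (ILess (IVar 2) col_rep) Skip (ISet 3 (IAdd (IVar 3) (ICon 1)))"
  have "runs W n d (Seq (mark edge_exps) (Seq ?c
    (Seq (IPut 4 (IGet 1 (IVar 2)) (IVar 2)) (ISet 2 (IAdd (IVar 2) (ICon 1)))))) (fill_state e) (15 + (2 + 2))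
    (fill_state (Suc e))" if e: "e < m" for e
  proof (rule runs_Seq [OF runs_mark_edges [OF e] runs_Seq])
    let ?s = "(fill_state e)\<lparr>rarr := (\<lambda>_ _. 0)(0 := point_table (Suc e))\<rparr>"
    let ?N = "card {k. k < Suc e \<and> c k = k}"
    have N: "?N = (if c e = e then Suc (card {k. k < e \<and> c k = k}) else card {k. k < e \<and> c k = k})"
    proof -
      have "{k. k < Suc e \<and> c k = k} = (if c e = e then insert e {k. k < e \<and> c k = k} else {k. k < e \<and> c k = k})"
        by (auto simp: less_Suc_eq)
      thus ?thesis by simp
    qed
    have "?N \<le> Suc e" using card_mono [of "{..<Suc e}" "{k. k < Suc e \<and> c k = k}"] by auto
    have ce: "e \<le> c e" "c e < m" using rep [OF e, of g] by auto
    show "runs W n d ?c ?s 2 (?s\<lparr>ivar := (ivar ?s)(3 := ?N)\<rparr>)"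
    proof -
      have val: "ival ?s col_rep = c e" "iok W ?s col_rep" "ival ?s (IVar 2) = e"
        "ival ?s (IVar 3) = card {k. k < e \<and> c k = k}"
        by (simp_all only: ival_rarr fill_values) (simp_all add: fill_state_def col_rep_def)
      have "runs W n d ?c ?s (1 + 1) (?s\<lparr>ivar := (ivar ?s)(3 := ?N)\<rparr>)"
      proof (rule runs_Cond)
        assume "holds d ?s (ILess (IVar 2) col_rep)"
        hence "c e \<noteq> e" using val by simp
        hence "?s\<lparr>ivar := (ivar ?s)(3 := ?N)\<rparr> = ?s" using N by (simp add: fill_state_def)
        thus "runs W n d Skip ?s 1 (?s\<lparr>ivar := (ivar ?s)(3 := ?N)\<rparr>)" using runs_Skip by simp
      next
        assume "\<not> holds d ?s (ILess (IVar 2) col_rep)"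
        hence "c e = e" using val ce by simp
        thus "runs W n d (ISet 3 (IAdd (IVar 3) (ICon 1))) ?s 1 (?s\<lparr>ivar := (ivar ?s)(3 := ?N)\<rparr>)"
          using val N \<open>?N \<le> Suc e\<close> e words by (intro runs_ISet_last) simp_all
      qed (use val in simp)
      thus ?thesis by (simp only: one_add_one)
    qed
    show "runs W n d (Seq (IPut 4 (IGet 1 (IVar 2)) (IVar 2)) (ISet 2 (IAdd (IVar 2) (ICon 1))))
      (?s\<lparr>ivar := (ivar ?s)(3 := ?N)\<rparr>) 2 (fill_state (Suc e))"
      by (intro runs_IPut_Seq runs_ISet_last)
        (use e words in \<open>simp_all add: fill_state_def fun_eq_iff\<close>)
  qed
  from runs_While [where T = 19, OF _ _ _, of m W n fill_state "ILess (IVar 2) (IVar 0)" d] this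
  show ?thesis unfolding fill_def by (simp add: fill_state_def)
qed

lemma card_column_reps: "card {k. k < m \<and> c k = k} = card (c ` {..<m})"
proof -
  have "{k. k < m \<and> c k = k} = c ` {..<m}" using c_less c_c by force
  thus ?thesis by simp
qed

text \<open>Division by the row length recovers an edge from its address. Edges descend in
  \<open>level\<close>, so at most one orientation is marked and 1/2 is subtracted at most
  once.\<close>

lemma tabulates_dist:
  assumes "ivar \<sigma> 1 = 7 * m" "rarr \<sigma> 0 = point_table m"
  shows "tabulates \<sigma> (7 * m) dist"
proof -
  let ?E = "edges m r c pv"
  have level: "level v < level u" if "(u, v) \<in> ?E" for u v
    using that by (auto simp: edges_def edge_list_def)
  have table: "point_table m (u * (7 * m) + v) = (if (u, v) \<in> ?E then 1 / 2 else 0)"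
    if uv: "u < 7 * m" "v < 7 * m" for u v
  proof -
    have "(u, v) \<in> ?E" if "(u', v') \<in> ?E" "u * (7 * m) + v = u' * (7 * m) + v'" for u' v'
    proof -
      have "v' < 7 * m" using adj_less(2) [of u' v'] that(1) by (simp add: adj_def)
      hence "(u * (7 * m) + v) div (7 * m) = u" "(u' * (7 * m) + v') div (7 * m) = u'"
        "(u * (7 * m) + v) mod (7 * m) = v" "(u' * (7 * m) + v') mod (7 * m) = v'"
        using uv by (simp_all add: mult.commute [of _ "7 * m"])
      thus ?thesis using that by metis
    qed
    hence "u * (7 * m) + v \<in> (\<lambda>(u, v). u * (7 * m) + v) ` ?E \<longleftrightarrow> (u, v) \<in> ?E" by force
    thus ?thesis by (simp add: point_table_def edges_def)
  qed
  have "(v, u) \<notin> ?E" "u \<noteq> v" if "(u, v) \<in> ?E" for u v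
    using level [of u v] level [of v u] that by auto
  thus ?thesis
    unfolding tabulates_def using assms by (auto simp: table dist_def adj_def)
qed

lemma runs_discount:
  fixes s :: state
  defines "good \<equiv> \<lambda>k. rarr s 8 k < 5 / 16 \<and> 7 / 16 < rarr s 9 k"
  shows "runs W n d discount s (ivar s 8 * 5 + 1)
    (s\<lparr>ivar := (ivar s)(8 := 0, 3 := ivar s 3 - card {k. k < ivar s 8 \<and> good k})\<rparr>)"
proof -
  let ?N = "ivar s 8"
  let ?n = "\<lambda>j. card {k. j \<le> k \<and> k < ?N \<and> good k}"
  \<comment> \<open>The loop goes from the last bar to the first, so after \<open>i\<close>
    iterations the bars from \<open>?N - i\<close> on have been counted.\<close>
  define \<sigma> where "\<sigma> i = s\<lparr>ivar := (ivar s)(8 := ?N - i, 3 := ivar s 3 - ?n (?N - i))\<rparr>" for i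
  let ?T = "RLess (RGet 8 (IVar 8)) (RDiv (RInt (ICon 5)) (RInt (ICon 16)))"
  let ?T' = "RLess (RDiv (RInt (ICon 7)) (RInt (ICon 16))) (RGet 9 (IVar 8))"
  let ?D = "ISet 3 (ISub (IVar 3) (ICon 1))"
  have step: "runs W n d (Seq (ISet 8 (ISub (IVar 8) (ICon 1))) (Cond ?T (Cond ?T' ?D Skip) Skip)) (\<sigma> i) 4 (\<sigma> (Suc i))"
    if i: "i < ?N" for i
  proof (rule runs_ISet_Seq)
    let ?s = "(\<sigma> i)\<lparr>ivar := (ivar (\<sigma> i))(8 := ival (\<sigma> i) (ISub (IVar 8) (ICon 1)))\<rparr>"
    let ?k = "?N - Suc i"
    have k: "ivar ?s 8 = ?k" and arr: "rarr ?s = rarr s" by (simp_all add: \<sigma>_def)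
    have set_eq: "{j. ?k \<le> j \<and> j < ?N \<and> good j} =
        (if good ?k then insert ?k {j. ?N - i \<le> j \<and> j < ?N \<and> good j} else {j. ?N - i \<le> j \<and> j < ?N \<and> good j})"
      using i by (auto simp: Suc_diff_Suc le_less)
    have card_eq: "?n ?k = (if good ?k then Suc (?n (?N - i)) else ?n (?N - i))"
      unfolding set_eq using i by simp
    have skip: "runs W n d Skip ?s 1 (\<sigma> (Suc i))" if "\<not> good ?k"
    proof -
      have "?s = \<sigma> (Suc i)" using that card_eq i by (simp add: \<sigma>_def fun_eq_iff)
      thus ?thesis using runs_Skip by simp
    qed
    have "runs W n d (Cond ?T (Cond ?T' ?D Skip) Skip) ?s (1 + (1 + 1)) (\<sigma> (Suc i))"
    proof (rule runs_Cond)
      assume T: "holds d ?s ?T"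
      show "runs W n d (Cond ?T' ?D Skip) ?s (1 + 1) (\<sigma> (Suc i))"
      proof (rule runs_Cond)
        assume "holds d ?s ?T'"
        hence "good ?k" using T k arr by (simp add: good_def)
        thus "runs W n d ?D ?s 1 (\<sigma> (Suc i))"
          using words card_eq i by (intro runs_ISet_last) (simp_all add: \<sigma>_def fun_eq_iff)
      next
        assume "\<not> holds d ?s ?T'"
        hence "\<not> good ?k" using k arr by (simp add: good_def)
        thus "runs W n d Skip ?s 1 (\<sigma> (Suc i))" by (rule skip)
      qed (use words in simp)
    next
      assume "\<not> holds d ?s ?T"
      hence "\<not> good ?k" using k arr by (simp add: good_def)
      thus "runs W n d Skip ?s (1 + 1) (\<sigma> (Suc i))" using runs_mono [OF skip] by simp
    qed (use words in simp)
    thus "runs W n d (Cond ?T (Cond ?T' ?D Skip) Skip) ?s (4 - 1) (\<sigma> (Suc i))"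
      by (simp add: numeral_eq_Suc)
  qed (use words in simp_all)
  have "runs W n d discount (\<sigma> 0) (?N * (4 + 1) + 1) (\<sigma> ?N)"
    unfolding discount_def by (rule runs_While) (use step words in \<open>simp_all add: \<sigma>_def\<close>)
  moreover have "\<sigma> 0 = s"
  proof -
    have "?n ?N = 0" by simp
    thus ?thesis unfolding \<sigma>_def diff_zero by (simp only:) simp
  qed
  ultimately show ?thesis by (simp add: \<sigma>_def)
qed

text \<open>The time bound adds \<open>5 * m + 1\<close> and \<open>20 * m + 1\<close> for the two
  passes, \<open>t\<close> for \<open>A\<close>, \<open>5 * t + 1\<close> for the bars, and five
  single assignments.\<close>

lemma runs_rank_com:
  assumes ivar0: "ivar s 0 = m" "\<And>x. 3 \<le> x \<Longrightarrow> ivar s x = 0"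
    and s: "rvar s = (\<lambda>_. 0)" "iarr s = (\<lambda>_ _. 0)(0 := f, 1 := g)" "rarr s = (\<lambda>_ _. 0)"
    and A: "exec W0 (7 * m) dist A (metric_input (7 * m)) t u" "W0 \<le> W" "barcode (output_bars u)"
  shows "\<exists>s'. runs W n d (rank_com A) s (25 * m + 6 * t + 8) s' \<and>
    ivar s' 0 = card (c ` {..<m}) - size {#I \<in># output_bars u. fst I < 5 / 16 \<and> ereal (7 / 16) < snd I#}"
proof -
  let ?\<tau> = "(fill_state m)\<lparr>ivar := (ivar (fill_state m))(8 := 7 * m)\<rparr>"
  have proj: "metric_input (7 * m) = proj ?\<tau>"
    by (simp add: proj_def metric_input_def zero_state_def fill_state_def fun_eq_iff)
  have "tabulates ?\<tau> (7 * m) dist"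
    by (rule tabulates_dist) (simp_all add: fill_state_def)
  moreover have "7 * m * (7 * m) + 1 \<le> W" using words by simp
  ultimately obtain \<rho> where \<rho>: "exec W n d (ren A) ?\<tau> t \<rho>" "proj \<rho> = u" "same_low ?\<tau> \<rho>"
    using exec_ren [OF A(1) proj _ A(2)] by blast
  define N where "N = ivar u 0"
  have \<rho>_u: "ivar \<rho> 8 = N" "rarr \<rho> 8 = rarr u 0" "rarr \<rho> 9 = rarr u 1"
    using \<rho>(2) by (auto simp: proj_def N_def)
  \<comment> \<open>Right endpoints exceed left endpoints, which are at least 0. So each bar has a
    nonzero cell in array 1, whose writing took a unit of time.\<close>
  have "N \<le> t"
  proof -
    have "rarr u 1 i \<noteq> 0" if "i < N" for i
    proof -
      have "(rarr u 0 i, ereal (rarr u 1 i)) \<in># output_bars u"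
        using that by (auto simp: output_bars_def N_def)
      thus ?thesis using A(3) by (force simp: barcode_def)
    qed
    hence "{..<N} \<subseteq> {i. rarr u 1 i \<noteq> 0}" by auto
    moreover have "finite {i. rarr u 1 i \<noteq> 0} \<and> card {i. rarr u 1 i \<noteq> 0} \<le> t"
      using exec_nonzero_entries [OF A(1), of 1] by (simp add: metric_input_def zero_state_def)
    ultimately show ?thesis using card_mono [of "{i. rarr u 1 i \<noteq> 0}" "{..<N}"] by auto
  qed
  let ?good = "\<lambda>k. rarr \<rho> 8 k < 5 / 16 \<and> 7 / 16 < rarr \<rho> 9 k"
  have size: "size {#I \<in># output_bars u. fst I < 5 / 16 \<and> ereal (7 / 16) < snd I#} = card {k. k < N \<and> ?good k}"
    by (simp add: output_bars_def filter_mset_image_mset \<rho>_u N_def)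
  let ?\<upsilon> = "\<rho>\<lparr>ivar := (ivar \<rho>)(8 := 0, 3 := ivar \<rho> 3 - card {k. k < ivar \<rho> 8 \<and> ?good k})\<rparr>"
  let ?end = "?\<upsilon>\<lparr>ivar := (ivar ?\<upsilon>)(0 := ivar ?\<upsilon> 3)\<rparr>"
  have disc: "runs W n d discount \<rho> (t * 5 + 1) ?\<upsilon>"
    by (rule runs_mono [OF runs_discount]) (use \<open>N \<le> t\<close> \<rho>_u(1) in simp)
  have A': "runs W n d (ren A) ?\<tau> t \<rho>" using \<rho>(1) by (auto simp: runs_def)
  have last: "runs W n d (ISet 0 (IVar 3)) ?\<upsilon> 1 ?end" by (rule runs_ISet_last) simp_all
  have copy: "runs W n d (ISet 8 (IVar 1)) (fill_state m) 1 ?\<tau>"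
    by (rule runs_ISet_last) (simp_all add: fill_state_def)
  have reset: "runs W n d (ISet 2 (ICon 0)) (scan_state m) 1 (fill_state 0)"
    by (rule runs_ISet_last) (simp_all add: scan_state_def fill_state_def point_table_def fun_eq_iff)
  let ?s1 = "s\<lparr>ivar := (ivar s)(1 := 7 * m)\<rparr>"
  have init1: "runs W n d (ISet 1 (IMul (ICon 7) (IVar 0))) s 1 ?s1"
    by (rule runs_ISet_last) (use ivar0 words in simp_all)
  have init2: "runs W n d (ISet 2 (ICon 0)) ?s1 1 (scan_state 0)"
  proof (rule runs_ISet_last)
    have "((ivar s)(1 := 7 * m, 2 := 0)) x = ((\<lambda>_. 0)(0 := m, 1 := 7 * m, 2 := 0)) x" for x
      using ivar0(1) ivar0(2) [of x] by (cases "x = 0 \<or> x = 1 \<or> x = 2") auto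
    moreover have "((\<lambda>_ _. 0)(0 := f, 1 := g)) a i = (iarr (scan_state 0)) a i" for a i
      by (simp add: scan_state_def)
    ultimately show "?s1\<lparr>ivar := (ivar ?s1)(2 := ival ?s1 (ICon 0))\<rparr> = scan_state 0"
      using s by (simp add: scan_state_def fun_eq_iff)
  qed simp_all
  have "runs W n d (rank_com A) s
    (1 + (1 + (m * 5 + 1 + (1 + (m * 20 + 1 + (1 + (t + (t * 5 + 1 + 1)))))))) ?end"
    unfolding rank_com_def
    by (rule runs_Seq [OF init1 runs_Seq [OF init2 runs_Seq [OF runs_scan runs_Seq [OF reset
      runs_Seq [OF runs_fill runs_Seq [OF copy runs_Seq [OF A' runs_Seq [OF disc last]]]]]]]])
  hence "runs W n d (rank_com A) s (25 * m + 6 * t + 8) ?end"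
    by (rule runs_mono) simp
  moreover have "ivar ?end 0 = card (c ` {..<m}) - card {k. k < N \<and> ?good k}"
    using \<rho>(3) by (simp add: same_low_def fill_state_def \<rho>_u(1) card_column_reps)
  ultimately show ?thesis unfolding size by (intro exI conjI)
qed

end

section \<open>Word size and asymptotic running time\<close>

lemma word_bounds:
  fixes m x w :: nat
  assumes "m + 2 \<le> x"
  shows "(7 * m + 2) ^ w \<le> x ^ (3 * w + 7)" "(7 * m + 2) * (7 * m + 2) + 16 \<le> x ^ (3 * w + 7)"
proof -
  \<comment> \<open>A cube absorbs the factor 7, so words for \<open>7 * m\<close> points stay
    polynomial in the size of the matrix input.\<close>
  have "7 * m + 2 \<le> (m + 2) ^ 3" by (simp add: power3_eq_cube algebra_simps)
  hence cube: "7 * m + 2 \<le> x ^ 3" using power_mono [OF assms, of 3] by linarith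
  have "(7 * m + 2) ^ w \<le> x ^ (3 * w)" using power_mono [OF cube, of w] by (simp add: power_mult)
  also have "\<dots> \<le> x ^ (3 * w + 7)" using assms by (intro power_increasing) auto
  finally show "(7 * m + 2) ^ w \<le> x ^ (3 * w + 7)" .
  \<comment> \<open>The square for the table addresses becomes \<open>x ^ 6\<close>, which is also
    at least 16, and doubling costs one more factor \<open>x\<close>; hence the 7 in the
    exponent.\<close>
  have "(7 * m + 2) * (7 * m + 2) \<le> x ^ 6"
    using mult_mono [OF cube cube] by (simp flip: power_add)
  moreover have "2 ^ 6 \<le> x ^ 6" using assms by (intro power_mono) auto
  moreover have "2 * x ^ 6 \<le> x * x ^ 6" using assms by (intro mult_right_mono) auto
  moreover have "x * x ^ 6 = x ^ 7" by (simp flip: power_Suc)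
  moreover have "x ^ 7 \<le> x ^ (3 * w + 7)" using assms by (intro power_increasing) auto
  ultimately show "(7 * m + 2) * (7 * m + 2) + 16 \<le> x ^ (3 * w + 7)" by simp
qed

text \<open>The number of nonzero columns is rank plus nullity, and the nullity is the number of
  long bars, so the difference left by the program is the rank.\<close>

lemma computes_rank_rank_com:
  assumes "approximates_vr_barcode 2 \<epsilon> A T" "\<epsilon> < 1 / 16"
  shows "computes_rank (rank_com A) (\<lambda>m. 25 * m + 6 * T (7 * m) + 8)"
proof -
  obtain w where A: "\<And>n d. Metric_space {..<n} d \<Longrightarrow> diam_le d {..<n} 1 \<Longrightarrow>
     \<exists>t s. exec ((n + 2) ^ w) n d A (metric_input n) t s \<and> t \<le> T n \<and> barcode (output_bars s) \<and>
        (\<exists>B. barcode_of B (vr_homology {..<n} d 2) \<and> bottleneck_dist (output_bars s) B \<le> ereal \<epsilon>)"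
    using assms(1) unfolding approximates_vr_barcode_def by blast
  show ?thesis
    unfolding computes_rank_def
  proof (rule exI [of _ "3 * w + 7"], intro allI impI)
    fix nr nc :: nat and M :: "bit mat" and es :: "(nat \<times> nat) list"
    assume M: "M \<in> carrier_mat nr nc" and es: "lists_entries es M"
    define m where "m = length es"
    define f where "f = (\<lambda>i. if i < length es then fst (es ! i) else 0)"
    define g where "g = (\<lambda>i. if i < length es then snd (es ! i) else 0)"
    define W where "W = (length es + nr + nc + 2) ^ (3 * w + 7)"
    have nth: "es ! e = (f e, g e)" if "e < length es" for e
      using that by (simp add: f_def g_def)
    have m_le: "m + 2 \<le> length es + nr + nc + 2" by (simp add: m_def)
    interpret entry_list m f g W
    proof
      show "e = e'" if "e < m" "e' < m" "f e = f e'" "g e = g e'" for e e'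
        using that es nth unfolding lists_entries_def m_def by (metis nth_eq_iff_index_eq)
    qed (unfold W_def, rule word_bounds(2) [OF m_le])
    obtain t s B where t: "exec ((7 * m + 2) ^ w) (7 * m) dist A (metric_input (7 * m)) t s" "t \<le> T (7 * m)"
      and bars: "barcode (output_bars s)" "barcode_of B (vr_homology {..<7 * m} dist 2)"
        "bottleneck_dist (output_bars s) B \<le> ereal \<epsilon>"
      using A [OF Metric_space_dist diam_le_dist] by blast
    have "(7 * m + 2) ^ w \<le> W" unfolding W_def by (rule word_bounds(1) [OF m_le])
    from runs_rank_com [of "matrix_input nr nc es", OF _ _ _ _ _ t(1) this bars(1), of 0 "\<lambda>_ _. 0"]
    obtain s' where s': "runs W 0 (\<lambda>_ _. 0) (rank_com A) (matrix_input nr nc es) (25 * m + 6 * t + 8) s'"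
      "ivar s' 0 = card (c ` {..<m}) - size {#I \<in># output_bars s. fst I < 5 / 16 \<and> ereal (7 / 16) < snd I#}"
      by (auto simp: matrix_input_def zero_state_def m_def f_def g_def)
    \<comment> \<open>Null vectors depend only on which entries share a row, and \<open>rep\<close>
      preserves this.\<close>
    have "null_vectors m r c = null_vectors m f c"
      using rep_eq_iff [of _ m _ f] by (auto simp: null_vectors_def cong: conj_cong)
    hence "(2 :: nat) ^ card (c ` {..<m}) =
        2 ^ (size {#I \<in># output_bars s. fst I < 5 / 16 \<and> ereal (7 / 16) < snd I#} + vec_space.rank nr M)"
      using card_null_vectors [OF M es nth] card_null_vectors_eq_long_bars [OF bars(2,3) assms(2)]
      by (simp add: m_def power_add)
    hence "ivar s' 0 = vec_space.rank nr M" using s'(2) by simp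
    moreover obtain t' where "t' \<le> 25 * m + 6 * t + 8"
      "exec W 0 (\<lambda>_ _. 0) (rank_com A) (matrix_input nr nc es) t' s'"
      using s'(1) by (auto simp: runs_def)
    ultimately show "\<exists>t s. exec ((length es + nr + nc + 2) ^ (3 * w + 7)) 0 (\<lambda>_ _. 0) (rank_com A) (matrix_input nr nc es) t s \<and>
        t \<le> 25 * length es + 6 * T (7 * length es) + 8 \<and> ivar s 0 = vec_space.rank nr M"
      using t(2) unfolding W_def m_def by (intro exI [of _ t'] exI [of _ s']) auto
  qed
qed

text \<open>Passing to \<open>7 * m\<close> points changes a power by a constant factor, and
  \<open>q \<ge> 1\<close> absorbs the linear overhead.\<close>

lemma bigo_rank_time:
  fixes T :: "nat \<Rightarrow> nat" and q :: real
  assumes "(\<lambda>n. real (T n)) \<in> O(\<lambda>n. real n powr q)" "q \<ge> 1"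
  shows "(\<lambda>m. real (25 * m + 6 * T (7 * m) + 8)) \<in> O(\<lambda>m. real m powr q)"
proof -
  have "filterlim (\<lambda>m :: nat. 7 * m) at_top at_top"
    by (rule filterlim_subseq) (simp add: strict_mono_def)
  from landau_o.big.compose [OF assms(1) this]
  have "(\<lambda>m. real (T (7 * m))) \<in> O(\<lambda>m. 7 powr q * real m powr q)"
    by (simp add: powr_mult)
  hence T: "(\<lambda>m. real (T (7 * m))) \<in> O(\<lambda>m. real m powr q)"
    by simp
  have "real m \<le> real m powr q" "1 \<le> real m powr q" if "m \<ge> 1" for m :: nat
    using that powr_mono [of 1 q "real m"] ge_one_powr_ge_zero [of "real m" q] assms(2) by simp_all
  hence "(\<lambda>m :: nat. real m) \<in> O(\<lambda>m. real m powr q)" "(\<lambda>m :: nat. 1 :: real) \<in> O(\<lambda>m. real m powr q)"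
    by (auto intro!: bigoI [where c = 1] eventually_sequentiallyI [where c = 1])
  hence "(\<lambda>m. 25 * real m + 6 * real (T (7 * m)) + 8 * 1) \<in> O(\<lambda>m. real m powr q)"
    using T by (intro sum_in_bigo) (simp_all only: landau_o.big.cmult_in_iff)
  thus ?thesis by simp
qed

theorem theorem40:
  shows "\<exists>\<epsilon>0 > 0. \<forall>\<epsilon> :: real. 0 < \<epsilon> \<longrightarrow> \<epsilon> < \<epsilon>0 \<longrightarrow>
    (\<forall>(A :: com) (q :: real). q \<ge> 1 \<longrightarrow>
      (\<exists>T. (\<lambda>n. real (T n)) \<in> O(\<lambda>n. real n powr q) \<and> approximates_vr_barcode 2 \<epsilon> A T) \<longrightarrow>
      (\<exists>P T. (\<lambda>m. real (T m)) \<in> O(\<lambda>m. real m powr q) \<and> computes_rank P T))"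
  using bigo_rank_time computes_rank_rank_com
  by (intro exI [of _ "1 / 16 :: real"] conjI allI impI) (simp, meson)

end
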